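(* Let $\mathcal{K}_{3,3}^3$ be the $3$-graph with the $15$ vertices $x_1,x_2,x_3,y_1,y_2,y_3$ and $z_{ij}$ ($1\le i,j\le 3$), and the $11$ edges $\{x_1,x_2,x_3\}$, $\{y_1,y_2,y_3\}$ and $\{x_i,y_j,z_{ij}\}$ for $1\le i,j\le 3$. For $n\ge 5$ let $T_5^3(n)$ be the $3$-graph on $n$ vertices obtained by partitioning the vertex set into $5$ parts of sizes $\lfloor n/5\rfloor$ or $\lceil n/5\rceil$ and taking as edges all triples whose three vertices lie in three distinct parts, and let $t_5^3(n)=e(T_5^3(n))$. Then $\mathrm{ex}(n,\mathcal{K}_{3,3}^3)=t_5^3(n)$ for all sufficiently large $n$. Moreover, if $n$ is sufficiently large and $G$ is a $\mathcal{K}_{3,3}^3$-free $3$-graph with $n$ vertices and $t_5^3(n)$ edges, then $G\cong T_5^3(n)$.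
   Context: A $3$-graph consists of a vertex set and a set of $3$-element subsets (edges). $G$ is $F$-free if it contains no (not necessarily induced) subgraph isomorphic to $F$. The Turán number $\mathrm{ex}(n,F)$ is the maximum number of edges in an $F$-free $3$-graph on $n$ vertices. *)

theory Defs
  imports Complex_Main "HOL-Library.Disjoint_Sets"
begin

record 'a hypergraph =
  verts :: "'a set"
  edges :: "'a set set"

text \<open>All $3$-graphs are finite.\<close>

definition three_graph :: "'a hypergraph \<Rightarrow> bool" where
  "three_graph G \<longleftrightarrow> finite (verts G) \<and> (\<forall>e\<in>edges G. e \<subseteq> verts G \<and> card e = 3)"

definition subgraph :: "'a hypergraph \<Rightarrow> 'a hypergraph \<Rightarrow> bool" where
  "subgraph H G \<longleftrightarrow> three_graph H \<and> verts H \<subseteq> verts G \<and> edges H \<subseteq> edges G"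

definition isomorphic :: "'a hypergraph \<Rightarrow> 'b hypergraph \<Rightarrow> bool" where
  "isomorphic G H \<longleftrightarrow> (\<exists>f. bij_betw f (verts G) (verts H) \<and> edges H = (\<lambda>e. f ` e) ` edges G)"

definition is_free :: "'b hypergraph \<Rightarrow> 'a hypergraph \<Rightarrow> bool" where
  "is_free F G \<longleftrightarrow> \<not> (\<exists>H. subgraph H G \<and> isomorphic H F)"

text \<open>Every finite $3$-graph is isomorphic to one with vertices in \<^typ>\<open>nat\<close>, so that type suffices
  for the maximum. If no $F$-free $3$-graph on $n$ vertices exists, the value is unspecified.\<close>

definition turan_number :: "nat \<Rightarrow> 'b hypergraph \<Rightarrow> nat" where
  "turan_number n F =
     Max {card (edges G) | G :: nat hypergraph. three_graph G \<and> card (verts G) = n \<and> is_free F G}"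

datatype k33_vertex = Vx nat | Vy nat | Vz nat nat

definition K33 :: "k33_vertex hypergraph" where
  "K33 = \<lparr>
     verts = Vx ` {1..3} \<union> Vy ` {1..3} \<union> {Vz i j | i j. i \<in> {1..3} \<and> j \<in> {1..3}},
     edges = {{Vx 1, Vx 2, Vx 3}, {Vy 1, Vy 2, Vy 3}}
       \<union> {{Vx i, Vy j, Vz i j} | i j. i \<in> {1..3} \<and> j \<in> {1..3}} \<rparr>"

definition complete_multipartite :: "'a set set \<Rightarrow> 'a hypergraph" where
  "complete_multipartite P = \<lparr>
     verts = \<Union>P,
     edges = {{a, b, c} | a b c. \<exists>A\<in>P. \<exists>B\<in>P. \<exists>C\<in>P.
                A \<noteq> B \<and> A \<noteq> C \<and> B \<noteq> C \<and> a \<in> A \<and> b \<in> B \<and> c \<in> C} \<rparr>"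

text \<open>The balanced partition of $\{0,\dots,n-1\}$ used to build the Turan $3$-graph is the one into
  residue classes modulo $5$; another balanced partition gives an isomorphic $3$-graph.\<close>

definition residue_parts :: "nat \<Rightarrow> nat set set" where
  "residue_parts n = (\<lambda>i. {v. v < n \<and> v mod 5 = i}) ` {..<5}"

definition turan_graph :: "nat \<Rightarrow> nat hypergraph" where
  "turan_graph n = complete_multipartite (residue_parts n)"

definition turan_size :: "nat \<Rightarrow> nat" where
  "turan_size n = card (edges (turan_graph n))"

lemma K33_counts: "three_graph K33" "card (verts K33) = 15" "card (edges K33) = 11"
proof -
  let ?I = "{1..3::nat}"
  have i: "?I = {1, 2, 3}" by auto
  have V: "{Vz i j | i j. i \<in> ?I \<and> j \<in> ?I} = (\<lambda>(i, j). Vz i j) ` (?I \<times> ?I)" by auto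
  have E: "{{Vx i, Vy j, Vz i j} | i j. i \<in> ?I \<and> j \<in> ?I} =
      (\<lambda>(i, j). {Vx i, Vy j, Vz i j}) ` (?I \<times> ?I)" by (auto; blast)
  show "three_graph K33"
    unfolding three_graph_def K33_def V by (auto simp: card_insert_if)
  have "card ((\<lambda>(i, j). Vz i j) ` (?I \<times> ?I)) = 9"
    by (subst card_image) (auto intro: inj_onI)
  moreover have "card (Vx ` ?I) = 3" "card (Vy ` ?I) = 3"
    by (subst card_image; auto intro: inj_onI)+
  moreover have "(Vx ` ?I \<union> Vy ` ?I) \<inter> (\<lambda>(i, j). Vz i j) ` (?I \<times> ?I) = {}"
    "Vx ` ?I \<inter> Vy ` ?I = {}" by auto
  ultimately show "card (verts K33) = 15"
    unfolding K33_def V by (simp add: card_Un_disjoint del: One_nat_def)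
  have "inj_on (\<lambda>(i, j). {Vx i, Vy j, Vz i j}) (?I \<times> ?I)"
  proof (rule inj_onI, clarify)
    fix i j i' j' assume "{Vx i, Vy j, Vz i j} = {Vx i', Vy j', Vz i' j'}"
    then have "Vz i j \<in> {Vx i', Vy j', Vz i' j'}" by blast
    then show "i = i' \<and> j = j'" by simp
  qed
  then have "card ((\<lambda>(i, j). {Vx i, Vy j, Vz i j}) ` (?I \<times> ?I)) = 9"
    by (subst card_image) auto
  moreover have "card {{Vx 1, Vx 2, Vx 3}, {Vy 1, Vy 2, Vy 3}} = 2"
  proof -
    have "{Vx 1, Vx 2, Vx 3} \<noteq> {Vy 1, Vy 2, Vy 3}" by blast
    then show ?thesis by (simp del: One_nat_def)
  qed
  moreover have "{{Vx 1, Vx 2, Vx 3}, {Vy 1, Vy 2, Vy 3}} \<inter>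
      (\<lambda>(i, j). {Vx i, Vy j, Vz i j}) ` (?I \<times> ?I) = {}"
  proof -
    have "e \<notin> {{Vx 1, Vx 2, Vx 3}, {Vy 1, Vy 2, Vy 3}}"
      if "e \<in> (\<lambda>(i, j). {Vx i, Vy j, Vz i j}) ` (?I \<times> ?I)" for e
    proof -
      from that obtain i j where "Vz i j \<in> e" by auto
      then show ?thesis by auto
    qed
    then show ?thesis by blast
  qed
  ultimately show "card (edges K33) = 11"
    unfolding K33_def E hypergraph.simps
    using card_Un_disjoint[of "{{Vx 1, Vx 2, Vx 3}, {Vy 1, Vy 2, Vy 3}}"
      "(\<lambda>(i, j). {Vx i, Vy j, Vz i j}) ` (?I \<times> ?I)"]
    by (simp only: finite.intros finite_imageI finite_cartesian_product finite_atLeastAtMost)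
qed

lemma residue_parts_partition:
  assumes "n \<ge> 5"
  shows "partition_on {..<n} (residue_parts n)" "card (residue_parts n) = 5"
proof -
  have ne: "i \<in> {v. v < n \<and> v mod 5 = i}" if "i < 5" for i
    using that assms by simp
  show "partition_on {..<n} (residue_parts n)"
  proof (rule partition_onI)
    show "\<Union> (residue_parts n) = {..<n}" unfolding residue_parts_def by auto
    show "{} \<notin> residue_parts n" using ne unfolding residue_parts_def by blast
    show "disjnt p q" if "p \<in> residue_parts n" "q \<in> residue_parts n" "p \<noteq> q" for p q
      using that unfolding residue_parts_def disjnt_def by auto
  qed
  have "inj_on (\<lambda>i. {v. v < n \<and> v mod 5 = i}) {..<5}"
  proof (rule inj_onI)
    fix i j :: nat
    assume "i \<in> {..<5}" and eq: "{v. v < n \<and> v mod 5 = i} = {v. v < n \<and> v mod 5 = j}"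
    then have "i < 5" by simp
    from ne[OF this] have "i mod 5 = j" unfolding eq by simp
    with \<open>i < 5\<close> show "i = j" by simp
  qed
  then show "card (residue_parts n) = 5"
    unfolding residue_parts_def by (simp add: card_image)
qed

lemma residue_parts_balanced:
  assumes "A \<in> residue_parts n"
  shows "int (card A) \<in> {\<lfloor>real n / 5\<rfloor>, \<lceil>real n / 5\<rceil>}"
proof -
  obtain i where i: "i < 5" "A = {v. v < n \<and> v mod 5 = i}"
    using assms unfolding residue_parts_def by auto
  have "A = (\<lambda>k. 5 * k + i) ` {..<(n + 4 - i) div 5}"
  proof (intro set_eqI iffI)
    fix v assume "v \<in> A"
    then have v: "v < n" "v mod 5 = i" using i by auto
    obtain k where k: "v = 5 * k + i" using mult_div_mod_eq[of 5 v] v(2) by metis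
    then have "Suc k * 5 \<le> n + 4 - i" using v(1) i(1) by simp
    then have "k < (n + 4 - i) div 5"
      by (simp add: less_eq_div_iff_mult_less_eq Suc_le_eq[symmetric])
    then show "v \<in> (\<lambda>k. 5 * k + i) ` {..<(n + 4 - i) div 5}" using k by blast
  next
    fix v assume "v \<in> (\<lambda>k. 5 * k + i) ` {..<(n + 4 - i) div 5}"
    then obtain k where "v = 5 * k + i" "k < (n + 4 - i) div 5" by blast
    then show "v \<in> A" using i by auto
  qed
  moreover have "inj_on (\<lambda>k. 5 * k + i) {..<(n + 4 - i) div 5}"
    by (rule inj_onI) simp
  ultimately have c: "card A = (n + 4 - i) div 5" by (simp add: card_image)
  have f: "\<lfloor>real n / 5\<rfloor> = int (n div 5)"
    using floor_divide_of_nat_eq[of n 5, where ?'a = real] by simp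
  have g: "\<lceil>real n / 5\<rceil> = int ((n + 4) div 5)"
  proof -
    have "\<lceil>real n / 5\<rceil> = - (- int n div 5)"
      using ceiling_divide_eq_div[of "int n" 5, where ?'a = real] by simp
    then show ?thesis by simp
  qed
  have "n div 5 \<le> (n + 4 - i) div 5" "(n + 4 - i) div 5 \<le> (n + 4) div 5"
    using i(1) by (auto intro: div_le_mono)
  moreover have "(n + 4) div 5 \<le> (n + 5) div 5" by (rule div_le_mono) simp
  moreover have "(n + 5) div 5 = Suc (n div 5)" by simp
  moreover have "b = a \<or> b = c" if "a \<le> b" "b \<le> c" "c \<le> d" "d = Suc a" for a b c d :: nat
    using that by linarith
  ultimately have "(n + 4 - i) div 5 = n div 5 \<or> (n + 4 - i) div 5 = (n + 4) div 5"
    by blast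
  then show ?thesis unfolding c f g by auto
qed

end

theory Submission
  imports Defs
begin

text \<open>The proof is by stability. Deleting the edges through pairs of small codegree turns a
  \<open>K33\<close>-free hypergraph, at the cost of \<open>O(n\<^sup>2)\<close> edges, into one in which any two edges
  have an uncovered cross pair. This property survives cloning a vertex, so one can symmetrize: in the
  end uncovered pairs are twins, all degrees are almost equal, and the hypergraph of twin classes is
  intersecting. Bounding class sizes by Turan's theorem in the links, almost maximal degrees then
  leave room for five classes only. To undo the symmetrization, use that a hypergraph
  containing an almost complete 5-partite one forces each vertex of almost maximal degree to have
  a home part, and that an edge with two vertices at home in the same part would create a copy of
  \<open>K33\<close>. The same extension argument brings back the deleted edges, and passing to large minimum
  degree by deleting vertices gives the exact result.\<close>

section \<open>Degrees, links and double counting\<close>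

text \<open>Five is natural on both sides: any two triples on five points intersect, while the six
  vertices \<open>Vx i\<close>, \<open>Vy j\<close> of \<open>K33\<close> lie pairwise in common
  edges and so need six colours. All that is used of \<open>K33\<close>-freeness is
  \<open>cross_sparse 15\<close>, where 15 = 9 + 6: nine new vertices must be found outside six
  given ones. The obstacle is that small positive codegrees can grow under cloning, so this
  threshold need not survive symmetrization. An uncovered pair, in contrast, pulls back to an
  uncovered pair; this is why the hypergraph is first cleaned down to \<open>cross_sparse 1\<close>,
  and why the cleaned edges have to be recovered afterwards. The numerical slack comes from one gap.
  Twice the degree is about 0.48 times \<open>n\<^sup>2\<close> in the extremal hypergraph, whereas
  the worst case without five dominating twin classes reaches only 0.474012; the threshold 0.478
  lies between. The tolerances for edge densities are then nested, each small against the next use: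
  1/10^13 for the cleaned hypergraph, 1/10^9 after removing its vertices of low degree, 1/1000 for
  degrees.\<close>

definition uniform3 :: "'a set \<Rightarrow> 'a set set \<Rightarrow> bool" where
  "uniform3 V E \<longleftrightarrow> finite V \<and> (\<forall>e\<in>E. e \<subseteq> V \<and> card e = 3)"

definition codeg :: "'a set set \<Rightarrow> 'a \<Rightarrow> 'a \<Rightarrow> nat" where
  "codeg E u v = card {w. {u, v, w} \<in> E}"

definition degree :: "'a set set \<Rightarrow> 'a \<Rightarrow> nat" where
  "degree E v = card {e \<in> E. v \<in> e}"

text \<open>Ordered pairs, so that the cardinality of a link is twice the degree; nearly all counts below
  are therefore stated for \<open>2 * degree\<close>, whose extremal value is \<open>12 / 25 * n\<^sup>2\<close>.\<close>

definition link :: "'a set set \<Rightarrow> 'a \<Rightarrow> ('a \<times> 'a) set" where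
  "link E v = {(x, y). {v, x, y} \<in> E}"

text \<open>Only disjoint \<open>X\<close> and \<open>Y\<close> are constrained, since
  \<open>codeg E x x = 0\<close> in a 3-graph. The main values of \<open>m\<close> are 15, which
  \<open>K33\<close>-freeness gives, and 1, which says that some cross pair is uncovered.\<close>

definition cross_sparse :: "nat \<Rightarrow> 'a set set \<Rightarrow> bool" where
  "cross_sparse m E \<longleftrightarrow> (\<forall>X\<in>E. \<forall>Y\<in>E. \<exists>x\<in>X. \<exists>y\<in>Y. codeg E x y < m)"

lemma uniform3_finite: "uniform3 V E \<Longrightarrow> finite V"
  by (simp add: uniform3_def)

lemma uniform3_finite_edges: "uniform3 V E \<Longrightarrow> finite E"
  unfolding uniform3_def by (metis PowI finite_Pow_iff finite_subset subsetI)

lemma uniform3_subset: "uniform3 V E \<Longrightarrow> F \<subseteq> E \<Longrightarrow> uniform3 V F"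
  unfolding uniform3_def by blast

lemma card_triple_iff: "card {x, y, z} = 3 \<longleftrightarrow> x \<noteq> y \<and> x \<noteq> z \<and> y \<noteq> z"
  by (auto simp: card_insert_if)

lemma uniform3_triple:
  assumes "uniform3 V E" "{x, y, z} \<in> E"
  shows "x \<noteq> y" "x \<noteq> z" "y \<noteq> z" "x \<in> V" "y \<in> V" "z \<in> V"
  using assms card_triple_iff[of x y z] unfolding uniform3_def by fastforce+

lemma uniform3_edgeE:
  assumes "uniform3 V E" "e \<in> E"
  obtains x y z where "e = {x, y, z}" "x \<noteq> y" "x \<noteq> z" "y \<noteq> z"
  using assms unfolding uniform3_def card_3_iff by metis

lemma link_subset: "uniform3 V E \<Longrightarrow> link E v \<subseteq> V \<times> V"
  unfolding link_def by (auto dest: uniform3_triple)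

lemma finite_link: "uniform3 V E \<Longrightarrow> finite (link E v)"
  by (rule finite_subset[OF link_subset]) (auto dest: uniform3_finite)

lemma finite_conbrs: "uniform3 V E \<Longrightarrow> finite {w. {u, v, w} \<in> E}"
  by (rule finite_subset[of _ V]) (auto dest: uniform3_triple uniform3_finite)

lemma codeg_le: "uniform3 V E \<Longrightarrow> codeg E u v \<le> card V"
  unfolding codeg_def by (rule card_mono) (auto dest: uniform3_triple uniform3_finite)

lemma codeg_same: "uniform3 V E \<Longrightarrow> codeg E v v = 0"
  unfolding codeg_def using uniform3_triple(1)[of V E v v] by fastforce

lemma codeg_commute: "codeg E u v = codeg E v u"
  unfolding codeg_def by (simp add: insert_commute)

lemma codeg_pos_iff: "uniform3 V E \<Longrightarrow> 0 < codeg E u v \<longleftrightarrow> (\<exists>w. {u, v, w} \<in> E)"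
  unfolding codeg_def using finite_conbrs by (auto simp: card_gt_0_iff)

lemma codeg_mono: "uniform3 V E \<Longrightarrow> F \<subseteq> E \<Longrightarrow> codeg F u v \<le> codeg E u v"
  unfolding codeg_def by (rule card_mono) (auto intro: finite_conbrs)

lemma cross_sparse_mono: "cross_sparse m E \<Longrightarrow> m \<le> k \<Longrightarrow> cross_sparse k E"
  unfolding cross_sparse_def by (meson order_less_le_trans)

lemma cross_sparse_subset:
  assumes "uniform3 V E" "cross_sparse m E" "F \<subseteq> E"
  shows "cross_sparse m F"
  unfolding cross_sparse_def
proof (intro ballI)
  fix X Y assume "X \<in> F" "Y \<in> F"
  then obtain x y where "x \<in> X" "y \<in> Y" "codeg E x y < m"
    using assms unfolding cross_sparse_def by blast
  then show "\<exists>x\<in>X. \<exists>y\<in>Y. codeg F x y < m"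
    using codeg_mono[OF assms(1,3), of x y] by (meson le_less_trans)
qed

lemma card_link:
  assumes "uniform3 V E"
  shows "card (link E v) = 2 * degree E v"
proof -
  let ?P = "\<lambda>e. {(x, y). {v, x, y} = e}"
  have 1: "card (?P e) = 2" "finite (?P e)" if e: "e \<in> E" "v \<in> e" for e
  proof -
    obtain a b where ab: "e = {v, a, b}" "v \<noteq> a" "v \<noteq> b" "a \<noteq> b"
      by (rule uniform3_edgeE[OF assms e(1)]) (use e(2) in blast)
    have "?P e = {(a, b), (b, a)}"
    proof (intro equalityI subsetI)
      fix p assume "p \<in> ?P e"
      then obtain x y where p: "p = (x, y)" "{v, x, y} = {v, a, b}" using ab by auto
      then have "{v, x, y} \<in> E" using ab e by simp
      then have "x \<noteq> y" "v \<noteq> x" "v \<noteq> y" using uniform3_triple[OF assms] by auto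
      moreover have "x \<in> {v, a, b}" "y \<in> {v, a, b}" unfolding p(2)[symmetric] by simp_all
      ultimately have "x \<in> {a, b}" "y \<in> {a, b}" "x \<noteq> y" by auto
      then show "p \<in> {(a, b), (b, a)}" using p(1) by auto
    qed (use ab in auto)
    then show "card (?P e) = 2" "finite (?P e)" using ab by auto
  qed
  have "link E v = (\<Union>e\<in>{e \<in> E. v \<in> e}. ?P e)" unfolding link_def by auto
  moreover have "card (\<Union>e\<in>{e \<in> E. v \<in> e}. ?P e) = (\<Sum>e\<in>{e \<in> E. v \<in> e}. card (?P e))"
    by (rule card_UN_disjoint) (use 1 uniform3_finite_edges[OF assms] in auto)
  ultimately show ?thesis using 1 unfolding degree_def by simp
qed

lemma sum_degree:
  assumes "uniform3 V E"
  shows "(\<Sum>v\<in>V. degree E v) = 3 * card E"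
  unfolding degree_def
proof (rule sum_multicount)
  show "finite V" "finite E" using assms uniform3_finite uniform3_finite_edges by auto
  show "\<forall>e\<in>E. card {v \<in> V. v \<in> e} = 3"
  proof
    fix e assume "e \<in> E"
    moreover then have "{v \<in> V. v \<in> e} = e" using assms unfolding uniform3_def by auto
    ultimately show "card {v \<in> V. v \<in> e} = 3" using assms unfolding uniform3_def by auto
  qed
qed

lemma degree_le:
  assumes "uniform3 V E"
  shows "2 * degree E v \<le> (card V)\<^sup>2"
proof -
  have "card (link E v) \<le> card (V \<times> V)"
    using assms by (intro card_mono link_subset) (auto dest: uniform3_finite)
  then show ?thesis by (simp add: card_link[OF assms] card_cartesian_product power2_eq_square)
qed

lemma card_edges_avoiding_ge:
  assumes "uniform3 V E" "Z \<subseteq> V"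
  shows "card E \<le> card {e \<in> E. e \<inter> Z = {}} + (\<Sum>v\<in>Z. degree E v)"
proof -
  have fin: "finite E" "finite Z"
    using uniform3_finite_edges[OF assms(1)] finite_subset[OF assms(2) uniform3_finite[OF assms(1)]]
    by auto
  have "E \<subseteq> {e \<in> E. e \<inter> Z = {}} \<union> (\<Union>v\<in>Z. {e \<in> E. v \<in> e})" by auto
  then have "card E \<le> card ({e \<in> E. e \<inter> Z = {}} \<union> (\<Union>v\<in>Z. {e \<in> E. v \<in> e}))"
    by (rule card_mono[rotated]) (use fin in auto)
  also have "\<dots> \<le> card {e \<in> E. e \<inter> Z = {}} + card (\<Union>v\<in>Z. {e \<in> E. v \<in> e})"
    by (rule card_Un_le)
  also have "card (\<Union>v\<in>Z. {e \<in> E. v \<in> e}) \<le> (\<Sum>v\<in>Z. degree E v)"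
    unfolding degree_def by (rule card_UN_le[OF fin(2)])
  finally show ?thesis by simp
qed

section \<open>Turan's bound for graphs given as symmetric relations\<close>

definition clique :: "('a \<times> 'a) set \<Rightarrow> 'a set \<Rightarrow> bool" where
  "clique R C \<longleftrightarrow> (\<forall>x\<in>C. \<forall>y\<in>C. x \<noteq> y \<longrightarrow> (x, y) \<in> R)"

text \<open>Erdos's proof: induct on the neighbourhood of a vertex of maximum degree.\<close>

lemma turan_graph_bound:
  fixes R :: "('a \<times> 'a) set"
  assumes "finite W" "R \<subseteq> W \<times> W" "sym R" "irrefl R"
    and "\<not> (\<exists>C\<subseteq>W. card C = Suc k \<and> clique R C)" "k \<ge> 1"
  shows "real k * real (card R) \<le> (real k - 1) * (real (card W))\<^sup>2"
  using assms(6,1-5)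
proof (induction k arbitrary: W R rule: dec_induct)
  case base
  have "(x, y) \<notin> R" for x y
  proof
    assume xy: "(x, y) \<in> R"
    then have "x \<noteq> y" "{x, y} \<subseteq> W" using base by (auto simp: irrefl_def)
    moreover have "clique R {x, y}" using xy base(3) by (auto simp: clique_def sym_def)
    ultimately show False using base(5) by (metis One_nat_def Suc_1 card_2_iff)
  qed
  then have "R = {}" by auto
  then show ?case by simp
next
  case (step k)
  show ?case
  proof (cases "W = {}")
    case True then show ?thesis using step.prems by auto
  next
    case False
    define d where "d x = card (R `` {x})" for x
    have Rfin: "finite R" using step.prems finite_subset by blast
    have sub: "R `` {x} \<subseteq> W" for x using step.prems by auto
    then have finN: "finite (R `` {x})" for x using step.prems(1) finite_subset by blast
    have "Max (d ` W) \<in> d ` W" using False step.prems(1) by simp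
    then obtain v where v: "v \<in> W" "d v = Max (d ` W)" by auto
    have dv: "d x \<le> d v" if "x \<in> W" for x using that v(2) step.prems(1) by simp
    define N where "N = R `` {v}"
    have N: "N \<subseteq> W" "finite N" using sub finN N_def by auto
    define R1 where "R1 = R \<inter> N \<times> N"
    have IH: "real k * real (card R1) \<le> (real k - 1) * (real (card N))\<^sup>2"
    proof (rule step.IH)
      show "finite N" "R1 \<subseteq> N \<times> N" using N R1_def by auto
      show "sym R1" using step.prems(3) unfolding R1_def sym_def by auto
      show "irrefl R1" using step.prems(4) unfolding R1_def irrefl_def by auto
      show "\<not> (\<exists>C\<subseteq>N. card C = Suc k \<and> clique R1 C)"
      proof
        assume "\<exists>C\<subseteq>N. card C = Suc k \<and> clique R1 C"
        then obtain C where C: "C \<subseteq> N" "card C = Suc k" "clique R1 C" by blast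
        have vC: "v \<notin> C" using C(1) step.prems(4) unfolding N_def irrefl_def by auto
        have "finite C" using C(1) N(2) finite_subset by blast
        then have "card (insert v C) = Suc (Suc k)" using vC C(2) by simp
        moreover have "clique R (insert v C)"
          using C step.prems(3) unfolding clique_def N_def R1_def sym_def by blast
        moreover have "insert v C \<subseteq> W" using v C N by auto
        ultimately show False using step.prems(5) by blast
      qed
    qed
    have degs: "card (Sigma (W - N) (\<lambda>x. R `` {x})) \<le> card (W - N) * card N"
    proof -
      have "card (Sigma (W - N) (\<lambda>x. R `` {x})) = (\<Sum>x\<in>W - N. d x)"
        unfolding d_def by (rule card_SigmaI) (use step.prems(1) finN in auto)
      also have "\<dots> \<le> (\<Sum>x\<in>W - N. card N)"
        by (rule sum_mono) (use dv N_def d_def in auto)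
      finally show ?thesis by simp
    qed
    \<comment> \<open>A pair not inside \<open>N\<close> has an end outside \<open>N\<close>; the
      converse relation covers the case that this is the second end.\<close>
    have "R \<subseteq> R1 \<union> Sigma (W - N) (\<lambda>x. R `` {x}) \<union> (Sigma (W - N) (\<lambda>x. R `` {x}))\<inverse>"
      using step.prems(2,3) unfolding R1_def sym_def by auto
    then have "card R \<le> card (R1 \<union> Sigma (W - N) (\<lambda>x. R `` {x}) \<union> (Sigma (W - N) (\<lambda>x. R `` {x}))\<inverse>)"
      by (rule card_mono[rotated]) (use Rfin R1_def step.prems(1) finN in auto)
    also have "\<dots> \<le> card R1 + card (W - N) * card N + card (W - N) * card N"
      using degs by (intro order_trans[OF card_Un_le] add_mono) (auto simp: card_inverse)
    finally have "card R \<le> card R1 + 2 * (card (W - N) * card N)" by simp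
    then have cR: "real (card R) \<le> real (card R1) + 2 * ((real (card W) - real (card N)) * real (card N))"
      using N step.prems(1) card_mono[OF step.prems(1) N(1)]
      by (simp add: card_Diff_subset flip: of_nat_mult of_nat_add of_nat_diff)
    define r w m K where "r = real (card R1)" and "w = real (card W)" and "m = real (card N)" and "K = real k"
    have K1: "K \<ge> 1" using step.hyps K_def by simp
    have "K * ((K + 1) * real (card R)) \<le> (K + 1) * (K * r) + 2 * K * (K + 1) * ((w - m) * m)"
      using mult_left_mono[OF cR, of "K * (K + 1)"] K1
      unfolding r_def w_def m_def by (simp add: algebra_simps)
    also have "\<dots> \<le> (K + 1) * ((K - 1) * m\<^sup>2) + 2 * K * (K + 1) * ((w - m) * m)"
      using IH K1 unfolding r_def m_def K_def by (intro add_right_mono mult_left_mono) auto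
    \<comment> \<open>The subtracted square vanishes when \<open>m\<close> is
      \<open>K / (K + 1)\<close> times \<open>w\<close>, the degree in the balanced complete graph
      with \<open>k + 1\<close> parts.\<close>
    also have "\<dots> = K * (K * w\<^sup>2) - (K * w - (K + 1) * m)\<^sup>2"
      by (simp add: algebra_simps power2_eq_square)
    also have "\<dots> \<le> K * (K * w\<^sup>2)" by simp
    finally have "(K + 1) * real (card R) \<le> K * w\<^sup>2" using K1 by simp
    then show ?thesis unfolding K_def w_def by (simp add: add.commute)
  qed
qed

section \<open>Symmetrized hypergraphs\<close>

definition rainbow :: "'a set \<Rightarrow> ('a \<Rightarrow> nat) \<Rightarrow> 'a set set \<Rightarrow> bool" where
  "rainbow V f E \<longleftrightarrow> f ` V \<subseteq> {..<5} \<and> (\<forall>e\<in>E. inj_on f e)"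

definition twin :: "'a set set \<Rightarrow> 'a \<Rightarrow> 'a \<Rightarrow> bool" where
  "twin E u v \<longleftrightarrow> link E u = link E v"

text \<open>The hypergraphs in which symmetrization gets stuck. Being cross-sparse now says that the
  hypergraph of twin classes is intersecting.\<close>

locale symmetrized =
  fixes V :: "'a set" and E :: "'a set set"
  assumes unif: "uniform3 V E"
    and sparse: "cross_sparse 1 E"
    and uncovered_twin: "\<And>u v. u \<in> V \<Longrightarrow> v \<in> V \<Longrightarrow> codeg E u v = 0 \<Longrightarrow> twin E u v"
begin

lemma twin_iff: "u \<in> V \<Longrightarrow> v \<in> V \<Longrightarrow> twin E u v \<longleftrightarrow> codeg E u v = 0"
proof (rule iffI)
  assume "u \<in> V" "v \<in> V" "twin E u v"
  then have "{u, v, w} \<notin> E" for w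
    using uniform3_triple(1)[OF unif, of v v w] unfolding twin_def link_def by blast
  then show "codeg E u v = 0" unfolding codeg_def by simp
qed (rule uncovered_twin)

lemma twin_sym: "twin E u v \<Longrightarrow> twin E v u"
  and twin_trans: "twin E u v \<Longrightarrow> twin E v w \<Longrightarrow> twin E u w"
  by (simp_all add: twin_def)

lemma edge_not_twin:
  assumes "{x, y, z} \<in> E" shows "\<not> twin E x y"
proof -
  have "codeg E x y > 0" using assms codeg_pos_iff[OF unif] by blast
  then show ?thesis using twin_iff uniform3_triple[OF unif assms] by auto
qed

lemma edges_meet:
  assumes "X \<in> E" "Y \<in> E"
  obtains x y where "x \<in> X" "y \<in> Y" "twin E x y"
proof -
  obtain x y where "x \<in> X" "y \<in> Y" "codeg E x y < 1"
    using sparse assms unfolding cross_sparse_def by blast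
  moreover then have "x \<in> V" "y \<in> V" using unif assms unfolding uniform3_def by auto
  ultimately show ?thesis using that uncovered_twin by auto
qed

definition cls :: "'a \<Rightarrow> 'a set" where "cls v = {u \<in> V. twin E v u}"

lemma finite_cls: "finite (cls v)" and cls_subset: "cls v \<subseteq> V"
  using uniform3_finite[OF unif] by (auto simp: cls_def)

text \<open>Colour each vertex by a twin chosen in \<open>A\<close>. Vertices of equal colour are
  then twins of each other, and no edge contains two twins.\<close>

lemma rainbow_of_dominating:
  assumes "finite A" "card A \<le> 5" "\<And>w. w \<in> V \<Longrightarrow> \<exists>a\<in>A. twin E w a"
  shows "\<exists>f. rainbow V f E"
proof -
  obtain g :: "'a \<Rightarrow> nat" where g: "inj_on g A" "g ` A \<subseteq> {..<5}"
    using card_le_inj[of A "{..<5::nat}"] assms(1,2) by auto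
  define rep where "rep w = (SOME a. a \<in> A \<and> twin E w a)" for w
  have rep: "rep w \<in> A" "twin E w (rep w)" if "w \<in> V" for w
    using someI_ex[of "\<lambda>a. a \<in> A \<and> twin E w a"] assms(3)[OF that] unfolding rep_def by auto
  have "rainbow V (g \<circ> rep) E"
    unfolding rainbow_def
  proof (intro conjI ballI inj_onI)
    show "(g \<circ> rep) ` V \<subseteq> {..<5}" using rep g by auto
    fix e x y assume e: "e \<in> E" "x \<in> e" "y \<in> e" and eq: "(g \<circ> rep) x = (g \<circ> rep) y"
    then have V: "x \<in> V" "y \<in> V" using unif unfolding uniform3_def by auto
    have "rep x = rep y" using eq inj_onD[OF g(1)] rep V by simp
    then have tw: "twin E x y" using rep V twin_trans twin_sym by metis
    show "x = y"
    proof (rule ccontr)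
      assume "x \<noteq> y"
      obtain a b c where "e = {a, b, c}" using uniform3_edgeE[OF unif e(1)] by metis
      with e \<open>x \<noteq> y\<close> have "\<exists>z. {x, y, z} = e" by auto
      then show False using edge_not_twin e(1) tw by metis
    qed
  qed
  then show ?thesis by blast
qed

lemma link_sub_cls:
  shows "link E v \<subseteq> (V - cls v) \<times> (V - cls v)"
proof clarify
  fix x y assume "(x, y) \<in> link E v"
  then have e: "{v, x, y} \<in> E" "{v, y, x} \<in> E" unfolding link_def by (simp_all add: insert_commute)
  show "x \<in> V - cls v \<and> y \<in> V - cls v"
    using edge_not_twin[OF e(1)] edge_not_twin[OF e(2)] uniform3_triple[OF unif e(1)]
    by (auto simp: cls_def)
qed

lemma sym_link: "sym (link E v)" and irrefl_link: "irrefl (link E v)"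
proof -
  show "sym (link E v)"
    by (rule symI) (simp add: link_def insert_commute)
  show "irrefl (link E v)"
    using uniform3_triple(3)[OF unif] unfolding irrefl_def link_def by blast
qed

text \<open>The link of \<open>v\<close> avoids the class of \<open>v\<close>, so Turan's bound
  applies on the complement. Read backwards, a large degree and a link without large cliques force a
  small class.\<close>

lemma degree_bound:
  assumes "\<not> (\<exists>C\<subseteq>V. card C = Suc k \<and> clique (link E v) C)" "k \<ge> 1"
  shows "real k * (2 * real (degree E v)) \<le> (real k - 1) * (real (card V) - real (card (cls v)))\<^sup>2"
proof -
  have "\<not> (\<exists>C\<subseteq>V - cls v. card C = Suc k \<and> clique (link E v) C)" using assms(1) by blast
  then have "real k * real (card (link E v)) \<le> (real k - 1) * (real (card (V - cls v)))\<^sup>2"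
    using uniform3_finite[OF unif] assms(2)
    by (intro turan_graph_bound link_sub_cls sym_link irrefl_link) auto
  moreover have "real (card (V - cls v)) = real (card V) - real (card (cls v))"
    using card_Diff_subset[OF finite_cls cls_subset] card_mono[OF uniform3_finite[OF unif] cls_subset]
    by (simp add: of_nat_diff)
  ultimately show ?thesis by (simp add: card_link[OF unif])
qed

lemma clique_meets:
  assumes C: "clique (link E v) C" "a \<in> C" "b \<in> C" "a \<noteq> b"
    and X: "X \<in> E" "\<And>x. x \<in> X \<Longrightarrow> \<not> twin E v x"
  shows "\<exists>x\<in>X. twin E a x \<or> twin E b x"
proof -
  have "{v, a, b} \<in> E" using C unfolding clique_def link_def by auto
  then obtain x y where "x \<in> X" "y \<in> {v, a, b}" "twin E x y" using edges_meet X(1) by metis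
  then show ?thesis using X(2) twin_sym by blast
qed

lemma clique_not_twin:
  assumes "clique (link E v) C" "a \<in> C" "b \<in> C" "a \<noteq> b"
  shows "\<not> twin E a b"
proof -
  have "{a, b, v} \<in> E" using assms unfolding clique_def link_def by (auto simp: insert_commute)
  then show ?thesis by (rule edge_not_twin)
qed

text \<open>The edge \<open>{w, x, y}\<close> meets \<open>{v, a, b}\<close> up to twins for all
  distinct \<open>a\<close>, \<open>b\<close> in \<open>C\<close>, and only \<open>x\<close> or
  \<open>y\<close> against \<open>a\<close> or \<open>b\<close> can be responsible. So at most one
  member of \<open>C\<close> is missed, while \<open>x\<close> and \<open>y\<close> are twins of at
  most one member each: \<open>card C\<close> is at most 1 + 1 + 1.\<close>

lemma clique_outside:
  assumes C: "clique (link E v) C" "card C \<ge> 3"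
    and w: "w \<in> V" "\<not> (\<exists>a\<in>insert v C. twin E w a)"
    and xy: "(x, y) \<in> link E w" "x \<notin> cls v" "y \<notin> cls v"
  shows "card C \<le> 3 \<and> (\<exists>a\<in>C. \<exists>b\<in>C. x \<in> cls a \<and> y \<in> cls b)"
proof -
  have fC: "finite C" using C(2) card.infinite by fastforce
  have e: "{w, x, y} \<in> E" using xy unfolding link_def by auto
  have V: "x \<in> V" "y \<in> V" using uniform3_triple[OF unif e] by auto
  have nt: "\<not> twin E v z" if "z \<in> {w, x, y}" for z
    using that w xy V twin_sym unfolding cls_def by blast
  have meets: "(twin E a x \<or> twin E a y) \<or> (twin E b x \<or> twin E b y)"
    if "a \<in> C" "b \<in> C" "a \<noteq> b" for a b
    using clique_meets[OF C(1) that e nt] w(2) twin_sym that by blast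
  have uniq: "a = b" if "a \<in> C" "b \<in> C" "twin E a z" "twin E b z" for a b z
    using clique_not_twin[OF C(1) that(1,2)] that(3,4) twin_sym twin_trans by blast
  define A where "A = {a \<in> C. twin E a x}"
  define B where "B = {a \<in> C. twin E a y}"
  have A1: "card A \<le> 1" and B1: "card B \<le> 1"
    using fC uniq unfolding A_def B_def by (auto simp: card_le_Suc0_iff_eq)
  have "card (C - (A \<union> B)) \<le> 1"
    using fC meets unfolding A_def B_def by (auto simp: card_le_Suc0_iff_eq)
  moreover have "card C = card (C - (A \<union> B)) + card (A \<union> B)"
    using card_Diff_subset[of "A \<union> B" C] card_mono[of C "A \<union> B"] fC by (auto simp: A_def B_def)
  moreover have "card (A \<union> B) \<le> card A + card B" by (rule card_Un_le)
  ultimately have "card C \<le> 1 + card A + card B" by linarith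
  then have "card C \<le> 3" "card A > 0" "card B > 0" using A1 B1 C(2) by auto
  then show ?thesis using V unfolding A_def B_def cls_def by (auto simp: card_gt_0_iff)
qed

lemma link_card_le:
  assumes "link E w \<subseteq> S" "finite S"
  shows "2 * real (degree E w) \<le> real (card S)"
  using card_mono[OF assms(2,1)] by (simp add: card_link[OF unif])

lemma not_both_in_cls: "(x, y) \<in> link E w \<Longrightarrow> x \<in> cls v \<Longrightarrow> y \<in> cls v \<Longrightarrow> False"
proof -
  assume "(x, y) \<in> link E w" "x \<in> cls v" "y \<in> cls v"
  then have "{x, y, w} \<in> E" "twin E x y"
    using twin_trans[of x v y] twin_sym[of v x] by (simp_all add: link_def cls_def insert_commute)
  then show False using edge_not_twin by blast
qed

lemma card_cls_le:
  assumes "q\<^sup>2 * (real (card V))\<^sup>2 \<le> (real (card V) - real (card (cls v)))\<^sup>2" "q \<ge> 0"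
  shows "real (card (cls v)) \<le> (1 - q) * real (card V)"
proof -
  have "q * real (card V) \<le> real (card V) - real (card (cls v))"
  proof (rule power2_le_imp_le)
    show "(q * real (card V))\<^sup>2 \<le> (real (card V) - real (card (cls v)))\<^sup>2"
      using assms(1) unfolding power_mult_distrib .
    show "0 \<le> real (card V) - real (card (cls v))"
      using card_mono[OF uniform3_finite[OF unif] cls_subset] by simp
  qed
  then show ?thesis by (simp add: algebra_simps)
qed

text \<open>The cases are cliques of size four, three, or less in the links. Each time the degree
  condition makes the classes small, and a vertex \<open>w\<close> outside at most five chosen
  classes would have too small a link. The case of size three is the tight one and dictates the
  threshold.\<close>

lemma rainbow_of_min_degree:
  assumes deg: "\<And>v. v \<in> V \<Longrightarrow> 2 * real (degree E v) \<ge> (478 / 1000) * (real (card V))\<^sup>2"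
  shows "\<exists>f. rainbow V f E"
proof (cases "V = {}")
  case True
  then show ?thesis by (intro rainbow_of_dominating[of "{}"]) auto
next
  case False
  define n where "n = real (card V)"
  define c where "c v = real (card (cls v))" for v
  have finV: "finite V" by (rule uniform3_finite[OF unif])
  have n: "n > 0" using False finV unfolding n_def by (simp add: card_gt_0_iff)
  have cn: "c v \<le> n" for v using card_mono[OF finV cls_subset] unfolding c_def n_def by simp
  have c0: "c v \<ge> 0" for v unfolding c_def by simp
  have cdiff: "real (card (V - cls v)) = n - c v" for v
    using card_Diff_subset[OF finite_cls cls_subset] cn[of v] unfolding c_def n_def
    by (simp add: of_nat_diff)
  define cross where "cross v = cls v \<times> (V - cls v) \<union> (V - cls v) \<times> cls v" for v
  have fcross: "finite (cross v)" for v unfolding cross_def using finite_cls finV by auto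
  have cross: "real (card (cross v)) \<le> 2 * (q * (1 - q)) * n\<^sup>2" if "c v \<le> q * n" "q \<le> 1/2" for v q
  proof -
    have "card (cross v) \<le> 2 * (card (cls v) * card (V - cls v))"
      unfolding cross_def using card_Un_le[of "cls v \<times> (V - cls v)" "(V - cls v) \<times> cls v"]
      by (simp add: card_cartesian_product mult.commute)
    then have "real (card (cross v)) \<le> real (2 * (card (cls v) * card (V - cls v)))"
      by (rule of_nat_mono)
    then have "real (card (cross v)) \<le> 2 * (c v * (n - c v))"
      using cdiff[of v] by (simp add: c_def)
    \<comment> \<open>Expanded, this says that \<open>c v * (n - c v)\<close> may be bounded by
      inserting \<open>q * n\<close> for \<open>c v\<close>, as is right below
      \<open>n / 2\<close>.\<close>
    moreover have "0 \<le> (q * n - c v) * ((1 - q) * n - c v)"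
    proof -
      have "q * n \<le> (1 - q) * n" using that n by (intro mult_right_mono) auto
      then show ?thesis using that by auto
    qed
    ultimately show ?thesis by (simp add: algebra_simps power2_eq_square)
  qed
  have deg': "2 * real (degree E v) \<ge> (478 / 1000) * n\<^sup>2" if "v \<in> V" for v
    using deg[OF that] unfolding n_def .
  have n2: "n\<^sup>2 > 0" using n by simp
  \<comment> \<open>Before anything is known about cliques, only the disjointness of link and class
    is available; 0.69 squared is 0.4761, just below 0.478.\<close>
  have c31: "c v \<le> (31 / 100) * n" if "v \<in> V" for v
  proof -
    have "2 * real (degree E v) \<le> real (card ((V - cls v) \<times> (V - cls v)))"
      by (rule link_card_le[OF link_sub_cls]) (use finV in auto)
    then have "(478 / 1000) * n\<^sup>2 \<le> (n - c v)\<^sup>2"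
      using deg'[OF that] cdiff[of v] by (simp add: card_cartesian_product power2_eq_square)
    then have "(69 / 100)\<^sup>2 * n\<^sup>2 \<le> (n - c v)\<^sup>2" using n2 by (simp add: power2_eq_square)
    then show ?thesis using card_cls_le[of "(69 / 100)" v] unfolding n_def c_def by simp
  qed
  show ?thesis
  proof (cases "\<exists>v\<in>V. \<exists>C\<subseteq>V. card C = 4 \<and> clique (link E v) C")
    case True
    then obtain v C where C: "v \<in> V" "C \<subseteq> V" "card C = 4" "clique (link E v) C" by blast
    show ?thesis
    proof (rule rainbow_of_dominating[of "insert v C"])
      show "finite (insert v C)" "card (insert v C) \<le> 5"
        using C finite_subset[OF C(2) finV] by (auto simp: card_insert_if)
      fix w assume w: "w \<in> V"
      show "\<exists>a\<in>insert v C. twin E w a"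
      proof (rule ccontr)
        assume nt: "\<not> ?thesis"
        \<comment> \<open>Four clique vertices are one too many for a pair avoiding
          \<open>cls v\<close>, and no pair lies inside one class. The bound becomes 2 * 0.31 * 0.69
          = 0.4278.\<close>
        have "link E w \<subseteq> cross v"
        proof clarify
          fix x y assume xy: "(x, y) \<in> link E w"
          have "x \<in> cls v \<or> y \<in> cls v"
            using clique_outside[OF C(4) _ w nt xy] C(3) by auto
          then show "(x, y) \<in> cross v"
            using not_both_in_cls[OF xy] subsetD[OF link_subset[OF unif] xy] unfolding cross_def by auto
        qed
        moreover have "real (card (cross v)) \<le> 2 * ((31 / 100) * (1 - (31 / 100))) * n\<^sup>2"
          by (rule cross[OF c31[OF C(1)]]) simp
        ultimately have "(478 / 1000) * n\<^sup>2 \<le> 2 * ((31 / 100) * (1 - (31 / 100))) * n\<^sup>2"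
          using link_card_le[OF _ fcross] deg'[OF w] by (meson order_trans)
        then show False using n2 by simp
      qed
    qed
  next
    case noK4: False
    \<comment> \<open>Turan's bound with \<open>k = 3\<close> turns 0.478 into 3/2 * 0.478 = 0.717,
      and 0.846 squared is just below that.\<close>
    have c154: "c v \<le> (154 / 1000) * n" if "v \<in> V" for v
    proof -
      have "\<not> (\<exists>C\<subseteq>V. card C = Suc 3 \<and> clique (link E v) C)" using noK4 that by auto
      from degree_bound[OF this] have "(717 / 1000) * n\<^sup>2 \<le> (n - c v)\<^sup>2"
        using deg'[OF that] by (simp add: n_def c_def)
      then have "(846 / 1000)\<^sup>2 * n\<^sup>2 \<le> (n - c v)\<^sup>2" using n2 by (simp add: power2_eq_square)
      then show ?thesis using card_cls_le[of "(846 / 1000)" v] unfolding n_def c_def by simp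
    qed
    show ?thesis
    proof (cases "\<exists>v\<in>V. \<exists>C\<subseteq>V. card C = 3 \<and> clique (link E v) C")
      case True
      then obtain v C where C: "v \<in> V" "C \<subseteq> V" "card C = 3" "clique (link E v) C" by blast
      then have fC: "finite C" using finV finite_subset by blast
      show ?thesis
      proof (rule rainbow_of_dominating[of "insert v C"])
        show "finite (insert v C)" "card (insert v C) \<le> 5"
          using C fC by (auto simp: card_insert_if)
        fix w assume w: "w \<in> V"
        show "\<exists>a\<in>insert v C. twin E w a"
        proof (rule ccontr)
          assume nt: "\<not> ?thesis"
          define U where "U = (\<Union>a\<in>C. cls a)"
          have fU: "finite U" unfolding U_def using fC finite_cls by auto
          have "card U \<le> (\<Sum>a\<in>C. card (cls a))" unfolding U_def by (rule card_UN_le[OF fC])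
          then have "real (card U) \<le> (\<Sum>a\<in>C. c a)" unfolding c_def by (simp flip: of_nat_sum)
          also have "\<dots> \<le> (\<Sum>a\<in>C. (154 / 1000) * n)" by (rule sum_mono) (use c154 C(2) in auto)
          finally have U: "real (card U) \<le> (462 / 1000) * n" using C(3) by simp
          \<comment> \<open>A pair avoiding \<open>cls v\<close> must now join two classes of
            \<open>C\<close>. The two contributions are 0.260568 and 0.213444, together
            0.474012.\<close>
          have "link E w \<subseteq> cross v \<union> U \<times> U"
          proof (rule subrelI)
            fix x y assume xy: "(x, y) \<in> link E w"
            have "x \<in> cls v \<or> y \<in> cls v \<or> (x, y) \<in> U \<times> U"
              using clique_outside[OF C(4) _ w nt xy] C(3) unfolding U_def by auto
            then show "(x, y) \<in> cross v \<union> U \<times> U"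
              using not_both_in_cls[OF xy] subsetD[OF link_subset[OF unif] xy]
              unfolding cross_def by auto
          qed
          then have "2 * real (degree E w) \<le> real (card (cross v \<union> U \<times> U))"
            by (rule link_card_le) (use fcross fU in auto)
          also have "\<dots> \<le> real (card (cross v)) + real (card U) * real (card U)"
            using card_Un_le[of "cross v" "U \<times> U"]
            by (simp add: card_cartesian_product flip: of_nat_mult of_nat_add)
          also have "\<dots> \<le> 2 * ((154 / 1000) * (1 - (154 / 1000))) * n\<^sup>2 + ((462 / 1000) * n) * ((462 / 1000) * n)"
            by (intro add_mono mult_mono cross U c154 C) (use n in auto)
          finally show False using deg'[OF w] n2 by (simp add: power2_eq_square)
        qed
      qed
    next
      case False
      have c023: "c v \<le> (23 / 1000) * n" if "v \<in> V" for v
      proof -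
        have "\<not> (\<exists>C\<subseteq>V. card C = Suc 2 \<and> clique (link E v) C)" using False that by auto
        from degree_bound[OF this] have "(956 / 1000) * n\<^sup>2 \<le> (n - c v)\<^sup>2"
          using deg'[OF that] by (simp add: n_def c_def)
        then have "(977 / 1000)\<^sup>2 * n\<^sup>2 \<le> (n - c v)\<^sup>2" using n2 by (simp add: power2_eq_square)
        then show ?thesis using card_cls_le[of "(977 / 1000)" v] unfolding n_def c_def by simp
      qed
      \<comment> \<open>Without triangles in the links all classes are tiny, and any edge
        \<open>e\<close> can replace the clique: every link pair of \<open>w\<close> meets one of
        its three classes.\<close>
      obtain v where v: "v \<in> V" using \<open>V \<noteq> {}\<close> by blast
      have "degree E v \<noteq> 0"
      proof
        assume "degree E v = 0"
        then show False using deg'[OF v] n2 by simp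
      qed
      then have "{e \<in> E. v \<in> e} \<noteq> {}" unfolding degree_def by fastforce
      then obtain e where e: "e \<in> E" by blast
      then have e3: "card e = 3" "e \<subseteq> V" "finite e"
        using unif finV finite_subset unfolding uniform3_def by blast+
      show ?thesis
      proof (rule rainbow_of_dominating[of e])
        show "finite e" "card e \<le> 5" using e3 by auto
        fix w assume w: "w \<in> V"
        show "\<exists>a\<in>e. twin E w a"
        proof (rule ccontr)
          assume nt: "\<not> ?thesis"
          define U where "U = (\<Union>a\<in>e. cls a)"
          have fU: "finite U" unfolding U_def using e3 finite_cls by auto
          have "card U \<le> (\<Sum>a\<in>e. card (cls a))" unfolding U_def by (rule card_UN_le[OF e3(3)])
          then have "real (card U) \<le> (\<Sum>a\<in>e. c a)" unfolding c_def by (simp flip: of_nat_sum)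
          also have "\<dots> \<le> (\<Sum>a\<in>e. (23 / 1000) * n)" by (rule sum_mono) (use c023 e3(2) in auto)
          finally have U: "real (card U) \<le> (69 / 1000) * n" using e3(1) by simp
          have "link E w \<subseteq> U \<times> V \<union> V \<times> U"
          proof (rule subrelI)
            fix x y assume xy: "(x, y) \<in> link E w"
            then have V: "x \<in> V" "y \<in> V" using subsetD[OF link_subset[OF unif] xy] by auto
            have "{w, x, y} \<in> E" using xy unfolding link_def by simp
            then obtain a z where "a \<in> e" "z \<in> {w, x, y}" "twin E a z"
              using edges_meet[OF e] by metis
            then have "x \<in> U \<or> y \<in> U" using nt V twin_sym unfolding U_def cls_def by blast
            then show "(x, y) \<in> U \<times> V \<union> V \<times> U" using V by auto
          qed
          then have "2 * real (degree E w) \<le> real (card (U \<times> V \<union> V \<times> U))"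
            by (rule link_card_le) (use finV fU in auto)
          also have "\<dots> \<le> 2 * (real (card U) * n)"
            using card_Un_le[of "U \<times> V" "V \<times> U"] unfolding n_def
            by (simp add: card_cartesian_product mult.commute flip: of_nat_mult of_nat_add)
          also have "\<dots> \<le> 2 * (((69 / 1000) * n) * n)"
            by (intro mult_left_mono mult_right_mono U) (use n in auto)
          finally show False using deg'[OF w] n2 by (simp add: power2_eq_square)
        qed
      qed
    qed
  qed
qed

end

section \<open>Symmetrization\<close>

text \<open>\<open>v\<close> becomes a copy of \<open>u\<close> by pulling \<open>E\<close> back
  along the map sending \<open>v\<close> to \<open>u\<close>. For \<open>u \<noteq> v\<close> no new
  edge contains both, since its image would be too small to be an edge.\<close>

definition clone :: "'a set \<Rightarrow> 'a set set \<Rightarrow> 'a \<Rightarrow> 'a \<Rightarrow> 'a set set" where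
  "clone V E u v = {e. e \<subseteq> V \<and> card e = 3 \<and> id(v := u) ` e \<in> E}"

lemma uniform3_clone: "uniform3 V E \<Longrightarrow> uniform3 V (clone V E u v)"
  by (simp add: uniform3_def clone_def)

lemma clone_triple_iff:
  assumes "uniform3 V E"
  shows "{x, y, z} \<in> clone V E u v \<longleftrightarrow>
    x \<in> V \<and> y \<in> V \<and> z \<in> V \<and> {(id(v := u)) x, (id(v := u)) y, (id(v := u)) z} \<in> E"
proof -
  have "card {x, y, z} = 3" if "{(id(v := u)) x, (id(v := u)) y, (id(v := u)) z} \<in> E"
    using uniform3_triple[OF assms that] by (auto simp: card_triple_iff)
  then show ?thesis unfolding clone_def by (auto simp del: fun_upd_apply)
qed

lemma clone_iff_avoiding:
  assumes "uniform3 V E" "v \<notin> e"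
  shows "e \<in> clone V E u v \<longleftrightarrow> e \<in> E"
proof -
  have "id(v := u) ` e = id ` e" by (rule image_cong) (use assms(2) in auto)
  then show ?thesis using assms(1) unfolding clone_def uniform3_def by fastforce
qed

text \<open>Edges of the clone map to edges of \<open>E\<close>, so a covered pair has a covered
  image. Hence the uncovered cross pair between the images of \<open>X\<close> and \<open>Y\<close>
  lifts.\<close>

lemma cross_sparse_clone:
  assumes "uniform3 V E" "cross_sparse 1 E"
  shows "cross_sparse 1 (clone V E u v)"
  unfolding cross_sparse_def
proof (intro ballI)
  let ?\<phi> = "id(v := u)" and ?E = "clone V E u v"
  fix X Y assume "X \<in> ?E" "Y \<in> ?E"
  then have "?\<phi> ` X \<in> E" "?\<phi> ` Y \<in> E" unfolding clone_def by auto
  then have "\<exists>a\<in>?\<phi> ` X. \<exists>b\<in>?\<phi> ` Y. codeg E a b < 1"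
    using assms(2) unfolding cross_sparse_def by simp
  then obtain x y where xy: "x \<in> X" "y \<in> Y" "codeg E (?\<phi> x) (?\<phi> y) < 1" by (auto simp del: id_def)
  have "codeg ?E x y < 1"
  proof (rule ccontr)
    assume "\<not> codeg ?E x y < 1"
    then obtain w where "{x, y, w} \<in> ?E"
      using codeg_pos_iff[OF uniform3_clone[OF assms(1)], of u v x y] by auto
    then have "{?\<phi> x, ?\<phi> y, ?\<phi> w} \<in> E" using clone_triple_iff[OF assms(1)] by blast
    then show False using codeg_pos_iff[OF assms(1)] xy(3) by (metis less_one not_gr_zero)
  qed
  then show "\<exists>x\<in>X. \<exists>y\<in>Y. codeg ?E x y < 1" using xy by blast
qed

lemma card_common_edges:
  assumes "uniform3 V E" "u \<noteq> v"
  shows "card {e \<in> E. u \<in> e \<and> v \<in> e} = codeg E u v"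
proof -
  have bij: "bij_betw (\<lambda>w. {u, v, w}) {w. {u, v, w} \<in> E} {e \<in> E. u \<in> e \<and> v \<in> e}"
  proof (rule bij_betwI')
    fix x y assume "x \<in> {w. {u, v, w} \<in> E}" "y \<in> {w. {u, v, w} \<in> E}"
    then have "x \<notin> {u, v}" "y \<notin> {u, v}" using uniform3_triple[OF assms(1)] by blast+
    then show "({u, v, x} = {u, v, y}) = (x = y)" by (auto simp: set_eq_iff)
  next
    fix e assume e: "e \<in> {e \<in> E. u \<in> e \<and> v \<in> e}"
    then have "card e = 3" using assms(1) unfolding uniform3_def by auto
    then have "card (e - {u, v}) = 1" using e assms(2) by (simp add: card_Diff_subset)
    then obtain w where "e - {u, v} = {w}" by (rule card_1_singletonE)
    then have "e = {u, v, w}" using e by blast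
    with e show "\<exists>w\<in>{w. {u, v, w} \<in> E}. e = {u, v, w}" by blast
  qed auto
  show ?thesis unfolding codeg_def using bij_betw_same_card[OF bij] by (rule sym)
qed

text \<open>The edges at \<open>v\<close> are replaced by copies of the edges at \<open>u\<close>;
  the codegree counts those edges at \<open>u\<close> that contain \<open>v\<close> and cannot be
  copied.\<close>

lemma card_clone:
  assumes E: "uniform3 V E" and uv: "u \<in> V" "v \<in> V" "u \<noteq> v"
  shows "card (clone V E u v) + degree E v + codeg E u v = card E + degree E u"
proof -
  let ?E = "clone V E u v" and ?\<phi> = "id(v := u)"
  have fin: "finite E" "finite ?E"
    using uniform3_finite_edges[OF E] uniform3_finite_edges[OF uniform3_clone[OF E]] by auto
  have split: "card F = card {e \<in> F. v \<notin> e} + card {e \<in> F. v \<in> e}" if "finite F" for F :: "'a set set"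
  proof -
    have "F = {e \<in> F. v \<notin> e} \<union> {e \<in> F. v \<in> e}" by blast
    then have "card F = card ({e \<in> F. v \<notin> e} \<union> {e \<in> F. v \<in> e})" by (rule arg_cong)
    also have "\<dots> = card {e \<in> F. v \<notin> e} + card {e \<in> F. v \<in> e}"
      by (rule card_Un_disjoint) (use that in auto)
    finally show ?thesis .
  qed
  have avoid: "{e \<in> ?E. v \<notin> e} = {e \<in> E. v \<notin> e}" using clone_iff_avoiding[OF E] by auto
  have bij: "bij_betw (\<lambda>e. insert v (e - {u})) {e \<in> E. u \<in> e \<and> v \<notin> e} {e \<in> ?E. v \<in> e}"
  proof (rule bij_betw_byWitness[where f' = "\<lambda>e. insert u (e - {v})"])
    show "\<forall>e\<in>{e \<in> E. u \<in> e \<and> v \<notin> e}. insert u (insert v (e - {u}) - {v}) = e" by auto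
    have un: "u \<notin> e" "?\<phi> ` e = insert u (e - {v})" if "e \<in> ?E" "v \<in> e" for e
    proof -
      show im: "?\<phi> ` e = insert u (e - {v})" using that(2) by (auto simp: image_iff)
      have "card (insert u (e - {v})) = 3" "card e = 3"
        using that(1) E im unfolding clone_def uniform3_def by auto
      moreover then have "finite e" using card.infinite by fastforce
      ultimately show "u \<notin> e" using that(2) uv(3)
        by (metis Diff_iff card_Diff_singleton diff_Suc_1 insert_absorb numeral_3_eq_3 n_not_Suc_n singletonD)
    qed
    show "\<forall>e\<in>{e \<in> ?E. v \<in> e}. insert v (insert u (e - {v}) - {u}) = e" using un by auto
    show "(\<lambda>e. insert u (e - {v})) ` {e \<in> ?E. v \<in> e} \<subseteq> {e \<in> E. u \<in> e \<and> v \<notin> e}"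
      using un uv unfolding clone_def by auto
    show "(\<lambda>e. insert v (e - {u})) ` {e \<in> E. u \<in> e \<and> v \<notin> e} \<subseteq> {e \<in> ?E. v \<in> e}"
    proof clarify
      fix e assume e: "e \<in> E" "u \<in> e" "v \<notin> e"
      then have "e \<subseteq> V" "card e = 3" "finite e"
        using E finite_subset unfolding uniform3_def by blast+
      moreover have "?\<phi> ` insert v (e - {u}) = e" using e by (auto simp: image_iff)
      ultimately show "insert v (e - {u}) \<in> ?E \<and> v \<in> insert v (e - {u})"
        using e uv unfolding clone_def by (auto simp: card_insert_if card_Diff_singleton)
    qed
  qed
  have "card {e \<in> ?E. v \<in> e} = card {e \<in> E. u \<in> e \<and> v \<notin> e}"
    using bij_betw_same_card[OF bij] by (rule sym)
  moreover have "degree E u = card {e \<in> E. u \<in> e \<and> v \<notin> e} + codeg E u v"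
    using split[of "{e \<in> E. u \<in> e}"] fin(1) card_common_edges[OF E uv(3)]
    by (simp add: degree_def conj_ac)
  moreover have "card E = card {e \<in> E. v \<notin> e} + degree E v" using split[OF fin(1)] by (simp add: degree_def)
  moreover have "card ?E = card {e \<in> E. v \<notin> e} + card {e \<in> ?E. v \<in> e}"
    using split[OF fin(2)] avoid by simp
  ultimately show ?thesis by linarith
qed

definition twin_pairs :: "'a set \<Rightarrow> 'a set set \<Rightarrow> ('a \<times> 'a) set" where
  "twin_pairs V E = {(x, y) \<in> V \<times> V. twin E x y}"

text \<open>Twin pairs not involving \<open>v\<close> persist, and \<open>v\<close> changes to the
  class of \<open>u\<close>. It had \<open>card B - 1\<close> twins besides itself and now has at
  least \<open>card A\<close>, which is more because \<open>v\<close> belongs to \<open>B\<close>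
  but not to \<open>A\<close>.\<close>

lemma twin_pairs_clone:
  assumes E: "uniform3 V E" and uv: "u \<in> V" "v \<in> V" "\<not> twin E u v"
    and le: "card {y \<in> V. twin E v y} \<le> card {y \<in> V. twin E u y}"
  shows "card (twin_pairs V E) < card (twin_pairs V (clone V E u v))"
proof -
  let ?E = "clone V E u v"
  have finV: "finite V" by (rule uniform3_finite[OF E])
  have neq: "u \<noteq> v" using uv(3) unfolding twin_def by auto
  have link: "link ?E x = {(y, z). y \<in> V \<and> z \<in> V \<and> {(id(v := u)) x, (id(v := u)) y, (id(v := u)) z} \<in> E}"
    if "x \<in> V" for x
    using that clone_triple_iff[OF E] unfolding link_def by auto
  have tw: "twin ?E x y" if "x \<in> V" "y \<in> V" "twin E ((id(v := u)) x) ((id(v := u)) y)" for x y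
    using that(3) unfolding twin_def link[OF that(1)] link[OF that(2)] unfolding link_def by blast
  define A where "A = {y \<in> V. twin E u y}"
  define B where "B = {y \<in> V. twin E v y}"
  define S where "S = {(x, y) \<in> V \<times> V. twin E x y \<and> x \<noteq> v \<and> y \<noteq> v}"
  have fin: "finite A" "finite B" "finite S" using finV unfolding A_def B_def S_def
    by (auto intro: finite_subset[of _ "V \<times> V"])
  have vB: "v \<in> B" "v \<notin> A" using uv unfolding A_def B_def twin_def by auto
  have "twin_pairs V E \<subseteq> S \<union> {v} \<times> B \<union> (B - {v}) \<times> {v}"
    using uv unfolding twin_pairs_def S_def A_def B_def twin_def by auto
  then have "card (twin_pairs V E) \<le> card (S \<union> {v} \<times> B \<union> (B - {v}) \<times> {v})"
    by (rule card_mono[rotated]) (use fin in auto)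
  also have "\<dots> \<le> card S + card B + card (B - {v})"
    by (intro order_trans[OF card_Un_le] add_mono) (auto simp: card_cartesian_product)
  also have "card (B - {v}) < card B" using vB fin by (intro psubset_card_mono) auto
  finally have 1: "card (twin_pairs V E) < card S + card A + card A"
    using le unfolding A_def B_def by linarith
  have "card (S \<union> {v} \<times> A \<union> A \<times> {v}) = card S + card A + card A"
    using fin vB by (subst card_Un_disjoint; auto simp: card_cartesian_product S_def)+
  moreover have "S \<union> {v} \<times> A \<union> A \<times> {v} \<subseteq> twin_pairs V ?E"
  proof -
    have "twin ?E x y" if "(x, y) \<in> S" for x y using that by (intro tw) (auto simp: S_def)
    moreover have "twin ?E v y" "twin ?E y v" if "y \<in> A" for y
      using that vB uv tw[of v y] tw[of y v] by (auto simp: A_def twin_def)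
    ultimately show ?thesis using uv unfolding twin_pairs_def S_def A_def by auto
  qed
  then have "card (S \<union> {v} \<times> A \<union> A \<times> {v}) \<le> card (twin_pairs V ?E)"
    by (rule card_mono[rotated]) (use finV in \<open>auto simp: twin_pairs_def intro: finite_subset[of _ "V \<times> V"]\<close>)
  ultimately show ?thesis using 1 by linarith
qed

text \<open>Zykov symmetrization, one vertex at a time. Cloning a vertex of much larger degree is allowed
  even if the two vertices are covered; this makes the final hypergraph almost regular.
  The measure orders hypergraphs lexicographically by the numbers of edges and of twin pairs.\<close>

lemma symmetrization_induct [consumes 2, case_names symmetrized step]:
  assumes "uniform3 V E" "cross_sparse 1 E"
    and base: "\<And>E. symmetrized V E \<Longrightarrow>
      (\<And>u v. u \<in> V \<Longrightarrow> v \<in> V \<Longrightarrow> degree E u \<le> degree E v + card V) \<Longrightarrow> P E"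
    and step: "\<And>E u v. uniform3 V E \<Longrightarrow> cross_sparse 1 E \<Longrightarrow> u \<in> V \<Longrightarrow> v \<in> V \<Longrightarrow>
      card E \<le> card (clone V E u v) \<Longrightarrow> P (clone V E u v) \<Longrightarrow> P E"
  shows "P E"
proof -
  \<comment> \<open>\<open>k\<close> exceeds every possible number of twin pairs, so a single
    natural number encodes the lexicographic order.\<close>
  define k where "k = Suc ((card V)\<^sup>2)"
  define \<mu> where "\<mu> E = card E * k + card (twin_pairs V E)" for E
  have finV: "finite V" using assms(1) by (rule uniform3_finite)
  have tp: "card (twin_pairs V E) < k" for E
  proof -
    have "card (twin_pairs V E) \<le> card (V \<times> V)"
      by (rule card_mono) (use finV in \<open>auto simp: twin_pairs_def\<close>)
    then show ?thesis unfolding k_def by (simp add: card_cartesian_product power2_eq_square)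
  qed
  have bound: "\<mu> E \<le> card (Pow V) * k + k" if "uniform3 V E" for E
  proof -
    have "card E \<le> card (Pow V)"
      by (rule card_mono) (use that finV in \<open>auto simp: uniform3_def\<close>)
    then show ?thesis unfolding \<mu>_def using tp[of E] by (intro add_mono mult_right_mono) auto
  qed
  show ?thesis
    using assms(1,2)
  proof (induction "card (Pow V) * k + k - \<mu> E" arbitrary: E rule: less_induct)
    case less
    note E = less.prems(1)
    have go: "P E" if uv: "u \<in> V" "v \<in> V"
      and c: "card E < card (clone V E u v) \<or> card E = card (clone V E u v) \<and>
        card (twin_pairs V E) < card (twin_pairs V (clone V E u v))" for u v
    proof (rule step[OF less.prems uv])
      show "card E \<le> card (clone V E u v)" using c by auto
      have "\<mu> E < \<mu> (clone V E u v)"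
      proof (cases "card E < card (clone V E u v)")
        case True
        then have "card E * k + k \<le> card (clone V E u v) * k"
          by (metis Suc_leI add.commute mult_Suc mult_le_mono1)
        then show ?thesis unfolding \<mu>_def using tp[of E] by linarith
      qed (use c in \<open>auto simp: \<mu>_def\<close>)
      with bound[OF uniform3_clone[OF E]]
      have "card (Pow V) * k + k - \<mu> (clone V E u v) < card (Pow V) * k + k - \<mu> E"
        by (meson diff_less_mono2 order_less_le_trans)
      then show "P (clone V E u v)"
        by (rule less.hyps[OF _ uniform3_clone[OF E] cross_sparse_clone[OF less.prems]])
    qed
    show ?case
    proof (rule ccontr)
      assume nP: "\<not> P E"
      \<comment> \<open>When no cloning gains edges, \<open>card_clone\<close> bounds differences of
        degrees by codegrees: equality on uncovered pairs, almost regularity on the others.\<close>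
      have deg: "degree E u \<le> degree E v + codeg E u v" if "u \<in> V" "v \<in> V" for u v
      proof (cases "u = v")
        case False
        moreover have "\<not> card E < card (clone V E u v)" using go[OF that] nP by blast
        ultimately show ?thesis using card_clone[OF E that] by linarith
      qed simp
      have "symmetrized V E"
      proof
        fix u v assume uv: "u \<in> V" "v \<in> V" "codeg E u v = 0"
        have c0: "codeg E v u = 0" using uv(3) codeg_commute by metis
        have eq: "degree E u = degree E v"
          using deg[OF uv(1,2)] deg[OF uv(2,1)] uv(3) c0 by simp
        show "twin E u v"
        proof (rule ccontr)
          assume nt: "\<not> twin E u v"
          then have nt': "\<not> twin E v u" and neq: "u \<noteq> v" by (auto simp: twin_def)
          \<comment> \<open>Degrees are equal and the codegree is zero, so cloning keeps the number
            of edges in either direction; copying from the larger class creates twin pairs.\<close>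
          show False
          proof (cases "card {y \<in> V. twin E v y} \<le> card {y \<in> V. twin E u y}")
            case True
            then show ?thesis using go[OF uv(1,2)] nP twin_pairs_clone[OF E uv(1,2) nt]
              card_clone[OF E uv(1,2) neq] eq uv(3) by auto
          next
            case False
            then show ?thesis using go[OF uv(2,1)] nP twin_pairs_clone[OF E uv(2,1) nt']
              card_clone[OF E uv(2,1) neq[symmetric]] eq c0 by auto
          qed
        qed
      qed (use less.prems in auto)
      moreover have "degree E u \<le> degree E v + card V" if "u \<in> V" "v \<in> V" for u v
        using deg[OF that] codeg_le[OF E, of u v] by simp
      ultimately show False using base nP by blast
    qed
  qed
qed

section \<open>Rainbow hypergraphs and part sizes\<close>

definition part :: "'a set \<Rightarrow> ('a \<Rightarrow> nat) \<Rightarrow> nat \<Rightarrow> 'a set" where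
  "part V f i = {x \<in> V. f x = i}"

text \<open>The complete multipartite 3-graph of a colouring. Unlike a partition, a colouring admits
  empty classes and can be changed at one vertex.\<close>

definition full :: "'a set \<Rightarrow> ('a \<Rightarrow> nat) \<Rightarrow> 'a set set" where
  "full V f = {e. e \<subseteq> V \<and> card e = 3 \<and> inj_on f e}"

lemma uniform3_full: "finite V \<Longrightarrow> uniform3 V (full V f)"
  by (auto simp: uniform3_def full_def)

lemma rainbow_subset_full: "uniform3 V E \<Longrightarrow> rainbow V f E \<Longrightarrow> E \<subseteq> full V f"
  by (auto simp: uniform3_def full_def rainbow_def)

lemma triple_in_full_iff:
  "{x, y, z} \<in> full V f \<longleftrightarrow> x \<in> V \<and> y \<in> V \<and> z \<in> V \<and> f x \<noteq> f y \<and> f x \<noteq> f z \<and> f y \<noteq> f z"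
proof -
  have "f x \<noteq> f y \<and> f x \<noteq> f z \<and> f y \<noteq> f z \<longleftrightarrow> card {x, y, z} = 3 \<and> inj_on f {x, y, z}"
    unfolding card_triple_iff by (auto simp: inj_on_def)
  then show ?thesis unfolding full_def by auto
qed

context
  fixes V :: "'a set" and f :: "'a \<Rightarrow> nat"
  assumes fin: "finite V" and col: "f ` V \<subseteq> {..<5}"
begin

lemma finite_part: "finite (part V f i)" and part_subset: "part V f i \<subseteq> V"
  using fin by (auto simp: part_def)

lemma sum_over_parts:
  fixes g :: "nat \<Rightarrow> real"
  shows "(\<Sum>x\<in>V. g (f x)) = (\<Sum>i<5. real (card (part V f i)) * g i)"
proof -
  have "(\<Sum>x\<in>V. g (f x)) = (\<Sum>i<5. \<Sum>x\<in>{x \<in> V. f x = i}. g (f x))"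
    by (rule sum.group[symmetric]) (use fin col in auto)
  also have "\<dots> = (\<Sum>i<5. real (card (part V f i)) * g i)"
    by (rule sum.cong) (auto simp: part_def)
  finally show ?thesis .
qed

lemma sum_card_parts: "(\<Sum>i<5. real (card (part V f i))) = real (card V)"
  using sum_over_parts[of "\<lambda>_. 1"] by simp

lemma degree_full:
  assumes "x \<in> V"
  defines "s \<equiv> (\<lambda>i. real (card (part V f i)))"
  shows "2 * real (degree (full V f) x) = (real (card V) - s (f x))\<^sup>2 + (s (f x))\<^sup>2 - (\<Sum>i<5. (s i)\<^sup>2)"
proof -
  let ?A = "V - part V f (f x)" and ?I = "{..<5} - {f x}"
  let ?U = "\<Union>i\<in>?I. part V f i \<times> part V f i"
  have fx: "f x < 5" using col assms(1) by auto
  have "link (full V f) x = ?A \<times> ?A - ?U"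
    using assms(1) col unfolding link_def triple_in_full_iff part_def by auto
  moreover have "?U \<subseteq> ?A \<times> ?A" by (auto simp: part_def)
  moreover have "finite ?U" using finite_part by auto
  ultimately have "real (card (link (full V f) x)) = real (card (?A \<times> ?A)) - real (card ?U)"
    using fin card_mono[of "?A \<times> ?A" ?U] by (simp add: card_Diff_subset of_nat_diff)
  moreover have "real (card ?A) = real (card V) - s (f x)"
    using card_Diff_subset[OF finite_part part_subset] card_mono[OF fin part_subset]
    unfolding s_def by (simp add: of_nat_diff)
  moreover have "real (card ?U) = (\<Sum>i\<in>?I. (s i)\<^sup>2)"
  proof -
    have "card ?U = (\<Sum>i\<in>?I. card (part V f i \<times> part V f i))"
      by (rule card_UN_disjoint) (use finite_part in \<open>auto simp: part_def\<close>)
    then show ?thesis by (simp add: card_cartesian_product s_def power2_eq_square)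
  qed
  moreover have "(\<Sum>i<5. (s i)\<^sup>2) = (s (f x))\<^sup>2 + (\<Sum>i\<in>?I. (s i)\<^sup>2)"
    by (rule sum.remove) (use fx in auto)
  ultimately show ?thesis
    by (simp add: card_link[OF uniform3_full[OF fin]] card_cartesian_product power2_eq_square)
qed

text \<open>Inclusion-exclusion for ordered triples of pairwise different colours, obtained here by
  summing degrees.\<close>

lemma card_full:
  defines "s \<equiv> (\<lambda>i. real (card (part V f i)))"
  shows "6 * real (card (full V f)) =
    real (card V) ^ 3 - 3 * real (card V) * (\<Sum>i<5. (s i)\<^sup>2) + 2 * (\<Sum>i<5. s i ^ 3)"
proof -
  let ?n = "real (card V)"
  have "6 * real (card (full V f)) = (\<Sum>x\<in>V. 2 * real (degree (full V f) x))"
    using arg_cong[OF sum_degree[OF uniform3_full[OF fin], of f], of real]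
    by (simp add: sum_distrib_left[symmetric])
  also have "\<dots> = (\<Sum>x\<in>V. (?n - s (f x))\<^sup>2 + (s (f x))\<^sup>2 - (\<Sum>i<5. (s i)\<^sup>2))"
    by (rule sum.cong) (auto simp: degree_full s_def)
  also have "\<dots> = (\<Sum>i<5. s i * ((?n - s i)\<^sup>2 + (s i)\<^sup>2 - (\<Sum>i<5. (s i)\<^sup>2)))"
    unfolding s_def by (rule sum_over_parts)
  also have "\<dots> = (\<Sum>i<5. ?n\<^sup>2 * s i - 2 * ?n * (s i)\<^sup>2 + 2 * s i ^ 3 - (\<Sum>i<5. (s i)\<^sup>2) * s i)"
    by (rule sum.cong) (auto simp: algebra_simps power2_eq_square power3_eq_cube)
  also have "\<dots> = ?n\<^sup>2 * (\<Sum>i<5. s i) - 2 * ?n * (\<Sum>i<5. (s i)\<^sup>2) + 2 * (\<Sum>i<5. s i ^ 3)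
      - (\<Sum>i<5. (s i)\<^sup>2) * (\<Sum>i<5. s i)"
    by (simp only: sum.distrib sum_subtractf sum_distrib_left)
  also have "(\<Sum>i<5. s i) = ?n" unfolding s_def by (rule sum_card_parts)
  finally show ?thesis by (simp add: power2_eq_square power3_eq_cube)
qed

text \<open>In terms of the deviations from \<open>n / 5\<close>, which sum to zero, the linear
  terms vanish. The cubic term is absorbed by \<open>d i \<le> 4 * n / 5\<close>, leaving the
  coefficient -9/5 + 8/5 = -1/5. This explicit penalty later forces almost equal parts.\<close>

lemma card_full_le:
  "6 * real (card (full V f)) \<le> 12 / 25 * real (card V) ^ 3
    - real (card V) / 5 * (\<Sum>i<5. (real (card (part V f i)) - real (card V) / 5)\<^sup>2)"
proof -
  define n where "n = real (card V)"
  define d where "d i = real (card (part V f i)) - n / 5" for i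
  define q where "q = (\<Sum>i<5. (d i)\<^sup>2)"
  define r where "r = (\<Sum>i<5. d i ^ 3)"
  have d0: "(\<Sum>i<5. d i) = 0"
    using sum_card_parts unfolding d_def n_def by (simp add: sum_subtractf)
  have s: "real (card (part V f i)) = d i + n / 5" for i unfolding d_def by simp
  have p2: "(\<Sum>i<5. (real (card (part V f i)))\<^sup>2) = q + n\<^sup>2 / 5"
  proof -
    have "(\<Sum>i<5. (real (card (part V f i)))\<^sup>2) = (\<Sum>i<5. (d i)\<^sup>2 + 2 * n / 5 * d i + n\<^sup>2 / 25)"
      unfolding s by (intro sum.cong) (simp_all add: power2_eq_square field_simps)
    also have "\<dots> = q + 2 * n / 5 * (\<Sum>i<5. d i) + n\<^sup>2 / 5"
      by (simp only: sum.distrib sum_distrib_left[symmetric] q_def) simp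
    finally show ?thesis using d0 by simp
  qed
  have p3: "(\<Sum>i<5. real (card (part V f i)) ^ 3) = r + 3 * n / 5 * q + n ^ 3 / 25"
  proof -
    have "(\<Sum>i<5. real (card (part V f i)) ^ 3)
        = (\<Sum>i<5. d i ^ 3 + 3 * n / 5 * (d i)\<^sup>2 + 3 * n\<^sup>2 / 25 * d i + n ^ 3 / 125)"
      unfolding s by (intro sum.cong) (simp_all add: power2_eq_square power3_eq_cube field_simps)
    also have "\<dots> = r + 3 * n / 5 * q + 3 * n\<^sup>2 / 25 * (\<Sum>i<5. d i) + n ^ 3 / 25"
      by (simp only: sum.distrib sum_distrib_left[symmetric] q_def r_def) simp
    finally show ?thesis using d0 by simp
  qed
  have "r \<le> (\<Sum>i<5. 4 * n / 5 * (d i)\<^sup>2)"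
    unfolding r_def
  proof (rule sum_mono)
    fix i
    have "d i \<le> 4 * n / 5" using card_mono[OF fin part_subset, of i] unfolding d_def n_def by simp
    then show "d i ^ 3 \<le> 4 * n / 5 * (d i)\<^sup>2"
      using mult_right_mono[of "d i" "4 * n / 5" "(d i)\<^sup>2"] by (simp add: power3_eq_cube power2_eq_square)
  qed
  also have "\<dots> = 4 * n / 5 * q" unfolding q_def by (rule sum_distrib_left[symmetric])
  finally have r: "r \<le> 4 * n / 5 * q" .
  have "6 * real (card (full V f)) = 12 / 25 * n ^ 3 - 9 / 5 * n * q + 2 * r"
    using card_full unfolding p2 p3 n_def[symmetric]
    by (simp add: algebra_simps power2_eq_square power3_eq_cube)
  also have "\<dots> \<le> 12 / 25 * n ^ 3 - n / 5 * q" using r by (simp add: algebra_simps)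
  finally show ?thesis unfolding q_def d_def n_def .
qed

lemma card_full_le': "real (card (full V f)) \<le> 2 / 25 * real (card V) ^ 3"
proof -
  have "0 \<le> real (card V) / 5 * (\<Sum>i<5. (real (card (part V f i)) - real (card V) / 5)\<^sup>2)"
    by (intro mult_nonneg_nonneg sum_nonneg) auto
  then show ?thesis using card_full_le by linarith
qed

end

lemma rainbow_card_le:
  assumes "uniform3 V E" "rainbow V f E"
  shows "real (card E) \<le> 2 / 25 * real (card V) ^ 3"
proof -
  have fin: "finite V" and col: "f ` V \<subseteq> {..<5}"
    using assms unfolding uniform3_def rainbow_def by auto
  have "card E \<le> card (full V f)"
    by (rule card_mono[OF uniform3_finite_edges[OF uniform3_full[OF fin]] rainbow_subset_full[OF assms]])
  then show ?thesis using card_full_le'[OF fin col] by linarith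
qed

text \<open>On average twice the degree is at least 6 * 0.0799 = 0.4794 times
  \<open>n\<^sup>2\<close>. Almost regularity costs \<open>2 * n\<close>, at most 0.0014 times
  \<open>n\<^sup>2\<close>, which leaves 0.478 at every vertex.\<close>

lemma symmetrized_rainbow:
  assumes "symmetrized V E"
    and reg: "\<And>u v. u \<in> V \<Longrightarrow> v \<in> V \<Longrightarrow> degree E u \<le> degree E v + card V"
    and "card V \<ge> 2000" "real (card E) \<ge> (799 / 10000) * real (card V) ^ 3"
  shows "\<exists>f. rainbow V f E"
proof -
  interpret symmetrized V E by fact
  define n where "n = real (card V)"
  have n: "n \<ge> 2000" using assms(3) unfolding n_def by simp
  have "\<exists>v\<in>V. 2 * real (degree E v) \<ge> (4794 / 10000) * n\<^sup>2"
  proof (rule ccontr)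
    assume "\<not> ?thesis"
    then have "(\<Sum>v\<in>V. 2 * real (degree E v)) < (\<Sum>v\<in>V. (4794 / 10000) * n\<^sup>2)"
      using assms(3) uniform3_finite[OF unif] by (intro sum_strict_mono) (auto simp: not_le)
    moreover have "(\<Sum>v\<in>V. 2 * real (degree E v)) = 6 * real (card E)"
      using arg_cong[OF sum_degree[OF unif], of real] by (simp add: sum_distrib_left[symmetric])
    ultimately show False using assms(4) unfolding n_def by (simp add: power2_eq_square power3_eq_cube)
  qed
  then obtain v where v: "v \<in> V" "2 * real (degree E v) \<ge> (4794 / 10000) * n\<^sup>2" by blast
  show ?thesis
  proof (rule rainbow_of_min_degree)
    fix u assume "u \<in> V"
    then have "degree E v \<le> degree E u + card V" using reg v by blast
    then have "real (degree E v) \<le> real (degree E u) + n" unfolding n_def by linarith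
    moreover have "2 * n \<le> (14 / 10000) * n\<^sup>2"
      using mult_right_mono[OF n, of n] n by (simp add: power2_eq_square)
    ultimately show "(478 / 1000) * (real (card V))\<^sup>2 \<le> 2 * real (degree E u)"
      using v(2) unfolding n_def[symmetric] by linarith
  qed
qed

text \<open>Symmetrization never loses edges, so a violation would persist into a symmetrized
  hypergraph; that one is dense enough to be 5-colourable, hence within the bound.\<close>

lemma cross_sparse_card_le:
  assumes "uniform3 V E" "cross_sparse 1 E" "card V \<ge> 2000"
  shows "real (card E) \<le> 2 / 25 * real (card V) ^ 3"
  using assms(1,2)
proof (induction rule: symmetrization_induct)
  case (symmetrized E)
  show ?case
  proof (rule ccontr)
    assume less: "\<not> ?thesis"
    have "0 \<le> real (card V) ^ 3" by simp
    then have "real (card E) \<ge> (799 / 10000) * real (card V) ^ 3" using less by linarith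
    then obtain f where "rainbow V f E" using symmetrized_rainbow symmetrized assms(3) by blast
    then show False using less rainbow_card_le symmetrized(1) unfolding symmetrized_def by blast
  qed
next
  case (step E u v)
  then show ?case by linarith
qed

section \<open>Extending a dense rainbow subhypergraph\<close>

lemma real_card_mono: "finite B \<Longrightarrow> A \<subseteq> B \<Longrightarrow> real (card A) \<le> real (card B)"
  by (simp add: card_mono)

lemma real_card_Un_le: "real (card (A \<union> B)) \<le> real (card A) + real (card B)"
  using card_Un_le[of A B] by (simp flip: of_nat_add)

lemma real_card_Diff_ge: "finite B \<Longrightarrow> real (card A) - real (card B) \<le> real (card (A - B))"
  using diff_card_le_card_Diff[of B A] by linarith

lemma real_card_Sigma_le:
  assumes "finite A" "\<And>x. x \<in> A \<Longrightarrow> finite (B x)" "\<And>x. x \<in> A \<Longrightarrow> real (card (B x)) \<le> b"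
  shows "real (card (Sigma A B)) \<le> real (card A) * b"
proof -
  have "real (card (Sigma A B)) = (\<Sum>x\<in>A. real (card (B x)))" using assms by (simp add: card_SigmaI)
  also have "\<dots> \<le> (\<Sum>x\<in>A. b)" by (rule sum_mono) (rule assms(3))
  finally show ?thesis by simp
qed

lemma real_card_Sigma_ge:
  assumes "finite A" "\<And>x. x \<in> A \<Longrightarrow> finite (B x)" "\<And>x. x \<in> A \<Longrightarrow> b \<le> real (card (B x))"
  shows "real (card A) * b \<le> real (card (Sigma A B))"
proof -
  have "(\<Sum>x\<in>A. b) \<le> (\<Sum>x\<in>A. real (card (B x)))" by (rule sum_mono) (rule assms(3))
  also have "\<dots> = real (card (Sigma A B))" using assms by (simp add: card_SigmaI)
  finally show ?thesis by simp
qed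

lemma three_other_colours:
  assumes "finite S" "card S \<le> 2"
  obtains k1 k2 k3 :: nat where "{k1, k2, k3} \<subseteq> {..<5} - S" "k1 \<noteq> k2" "k1 \<noteq> k3" "k2 \<noteq> k3"
proof -
  have "3 \<le> card ({..<5} - S)" using diff_card_le_card_Diff[OF assms(1), of "{..<5}"] assms(2) by simp
  then obtain T where "T \<subseteq> {..<5} - S" "card T = 3" by (metis obtain_subset_with_card_n)
  then show ?thesis using that unfolding card_3_iff by metis
qed

text \<open>A dense rainbow subhypergraph pins down the whole hypergraph: every vertex of nearly maximal
  degree has a home colour and is joined to almost all vertices of the other four colours. The
  constants below are 1/1000 for exceptional codegrees, 1/250 for a negligible part of a
  neighbourhood and 1/25 for the defect of a vertex with a home.\<close>

locale dense_rainbow =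
  fixes V :: "'a set" and E H :: "'a set set" and f :: "'a \<Rightarrow> nat" and n :: real
  assumes unif: "uniform3 V E"
    and sparse: "cross_sparse 15 E"
    and HE: "H \<subseteq> E"
    and rb: "rainbow V f H"
    and dense: "real (card H) \<ge> (2 / 25 - 1 / 10 ^ 9) * n ^ 3"
    and n_def: "n = real (card V)"
    and n_large: "n \<ge> 10 ^ 6"
begin

abbreviation "P \<equiv> part V f"

definition nb :: "'a \<Rightarrow> 'a set" where "nb v = {y \<in> V. 15 \<le> codeg E v y}"

definition M :: "'a set set" where "M = full V f - H"

lemma finV: "finite V" using unif by (rule uniform3_finite)

lemma col: "f ` V \<subseteq> {..<5}" using rb unfolding rainbow_def by blast

lemma finP: "finite (P k)" and P_subset: "P k \<subseteq> V"
  using finV by (auto simp: part_def)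

lemma n_pos: "n > 0" using n_large by simp

lemma H_full: "H \<subseteq> full V f"
  by (rule rainbow_subset_full[OF uniform3_subset[OF unif HE] rb])

lemma fin_full: "finite (full V f)"
  by (rule uniform3_finite_edges[OF uniform3_full[OF finV]])

lemma part_sizes:
  assumes "i < 5" shows "\<bar>real (card (P i)) - n / 5\<bar> \<le> n / 5000"
proof -
  define q where "q = (\<Sum>i<5. (real (card (P i)) - n / 5)\<^sup>2)"
  have "6 * real (card H) \<le> 12 / 25 * n ^ 3 - n / 5 * q"
    using card_full_le[OF finV col] real_card_mono[OF fin_full H_full] unfolding q_def n_def by linarith
  then have "n * q \<le> n * (30 / 10 ^ 9 * n\<^sup>2)"
    using dense by (simp add: power2_eq_square power3_eq_cube algebra_simps)
  then have "q \<le> 30 / 10 ^ 9 * n\<^sup>2" using n_pos by simp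
  also have "\<dots> \<le> (n / 5000)\<^sup>2" by (simp add: power_divide)
  finally have "q \<le> (n / 5000)\<^sup>2" .
  moreover have "(real (card (P i)) - n / 5)\<^sup>2 \<le> q"
    unfolding q_def by (rule member_le_sum) (use assms in auto)
  ultimately have "(real (card (P i)) - n / 5)\<^sup>2 \<le> (n / 5000)\<^sup>2" by (rule order_trans[rotated])
  then show ?thesis using n_pos by (simp add: abs_le_square_iff[symmetric])
qed

lemma part_ge: "i < 5 \<Longrightarrow> real (card (P i)) \<ge> 999 / 5000 * n"
  by (drule part_sizes) linarith

lemma card_M: "real (card M) \<le> n ^ 3 / 10 ^ 9"
proof -
  have "real (card M) = real (card (full V f)) - real (card H)"
    using card_Diff_subset[OF finite_subset[OF H_full fin_full] H_full] card_mono[OF fin_full H_full]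
    unfolding M_def by (simp add: of_nat_diff)
  then show ?thesis using card_full_le'[OF finV col] dense
    by (simp add: n_def algebra_simps)
qed

text \<open>The three sets span at least \<open>8 * n ^ 3 / 10 ^ 9\<close> multicoloured triples,
  and \<open>card_M\<close> allows only an eighth of these to be absent from
  \<open>H\<close>.\<close>

lemma triple_exists:
  assumes sub: "A \<subseteq> P i" "B \<subseteq> P j" "C \<subseteq> P k" and ne: "i \<noteq> j" "i \<noteq> k" "j \<noteq> k"
    and large: "n / 500 \<le> real (card A)" "n / 500 \<le> real (card B)" "n / 500 \<le> real (card C)"
  shows "\<exists>a\<in>A. \<exists>b\<in>B. \<exists>c\<in>C. {a, b, c} \<in> H"
proof (rule ccontr)
  assume none: "\<not> ?thesis"
  let ?t = "\<lambda>(a, b, c). {a, b, c}"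
  have inP: "a \<in> V" "f a = i" if "a \<in> A" for a using that sub(1) by (auto simp: part_def)
  have inP': "b \<in> V" "f b = j" if "b \<in> B" for b using that sub(2) by (auto simp: part_def)
  have inP'': "c \<in> V" "f c = k" if "c \<in> C" for c using that sub(3) by (auto simp: part_def)
  have inj: "inj_on ?t (A \<times> B \<times> C)"
  proof (rule inj_onI)
    fix p q assume p: "p \<in> A \<times> B \<times> C" and q: "q \<in> A \<times> B \<times> C" and eq: "?t p = ?t q"
    obtain a b c where p': "p = (a, b, c)" "a \<in> A" "b \<in> B" "c \<in> C" using p by blast
    obtain a' b' c' where q': "q = (a', b', c')" "a' \<in> A" "b' \<in> B" "c' \<in> C" using q by blast
    have "{a, b, c} = {a', b', c'}" using eq unfolding p' q' prod.case .
    then have "a \<in> {a', b', c'}" "b \<in> {a', b', c'}" "c \<in> {a', b', c'}" by auto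
    then show "p = q"
      using inP[OF p'(2)] inP'[OF p'(3)] inP''[OF p'(4)] inP[OF q'(2)] inP'[OF q'(3)] inP''[OF q'(4)]
        ne p'(1) q'(1) by auto
  qed
  have "?t ` (A \<times> B \<times> C) \<subseteq> M"
    unfolding M_def using none inP inP' inP'' ne by (auto simp: triple_in_full_iff)
  then have "card (A \<times> B \<times> C) \<le> card M"
    using card_inj_on_le[OF inj] fin_full unfolding M_def by blast
  then have le: "real (card A) * (real (card B) * real (card C)) \<le> n ^ 3 / 10 ^ 9"
    using card_M by (simp add: card_cartesian_product flip: of_nat_mult)
  have "n / 500 * (n / 500 * (n / 500)) \<le> real (card A) * (real (card B) * real (card C))"
    using large n_pos by (intro mult_mono) auto
  with le have "8 * n ^ 3 \<le> n ^ 3" by (simp add: power3_eq_cube field_simps)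
  then show False using n_pos by simp
qed

text \<open>An edge of \<open>H\<close> inside the three sets of common neighbours would have
  codegree at least 15 with \<open>X\<close> in all nine pairs. The later contradictions with
  \<open>sparse\<close> in this context all go through this one.\<close>

lemma no_common_neighbours:
  assumes "X \<in> E" "{k1, k2, k3} \<subseteq> {..<5}" "k1 \<noteq> k2" "k1 \<noteq> k3" "k2 \<noteq> k3"
    and large: "\<And>k. k \<in> {k1, k2, k3} \<Longrightarrow> n / 500 \<le> real (card {y \<in> P k. \<forall>x\<in>X. y \<in> nb x})"
  shows False
proof -
  let ?Y = "\<lambda>k. {y \<in> P k. \<forall>x\<in>X. y \<in> nb x}"
  have "\<exists>a\<in>?Y k1. \<exists>b\<in>?Y k2. \<exists>c\<in>?Y k3. {a, b, c} \<in> H"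
    by (rule triple_exists[of _ k1 _ k2 _ k3]) (use assms(3-5) large in auto)
  then obtain a b c where abc: "a \<in> ?Y k1" "b \<in> ?Y k2" "c \<in> ?Y k3" "{a, b, c} \<in> E" using HE by blast
  obtain x y where "x \<in> X" "y \<in> {a, b, c}" "codeg E x y < 15"
    using sparse assms(1) abc(4) unfolding cross_sparse_def by blast
  then show False using abc unfolding nb_def by auto
qed

definition bad :: "'a set" where
  "bad = {a \<in> V. \<exists>j<5. j \<noteq> f a \<and> n / 1000 < real (card (P j - nb a))}"

lemma fin_bad: "finite bad" using finV by (simp add: bad_def)

lemma codeg_small: "y \<in> V \<Longrightarrow> y \<notin> nb v \<Longrightarrow> real (card {w. {v, y, w} \<in> E}) \<le> 14"
  unfolding nb_def codeg_def[symmetric] by auto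

text \<open>A bad vertex sees more than \<open>n / 1000\<close> vertices of one part with codegree
  at most 14, and each of these lacks at least \<open>n / 6\<close> triples into a third part.
  Summing these missing triples over \<open>bad\<close> gives at most
  \<open>6 * card M\<close>.\<close>

lemma card_bad: "real (card bad) \<le> n / 10 ^ 4"
proof -
  have uM: "uniform3 V M" using uniform3_subset[OF uniform3_full[OF finV]] unfolding M_def by blast
  have d: "n\<^sup>2 / 6000 \<le> 2 * real (degree M a)" if a: "a \<in> bad" for a
  proof -
    obtain j where j: "j < 5" "j \<noteq> f a" "n / 1000 < real (card (P j - nb a))" and aV: "a \<in> V"
      using a unfolding bad_def by auto
    have "card {j, f a} \<le> 2" by (simp add: card_insert_if)
    then obtain k where k: "k < 5" "k \<noteq> j" "k \<noteq> f a"
      using three_other_colours[of "{j, f a}"] by (metis Diff_iff finite.emptyI finite_insert insert_subset insertCI lessThan_iff)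
    define S where "S = Sigma (P j - nb a) (\<lambda>y. P k - {z. {a, y, z} \<in> E})"
    have "real (card (P j - nb a)) * (n / 6) \<le> real (card S)"
      unfolding S_def
    proof (rule real_card_Sigma_ge)
      fix y assume y: "y \<in> P j - nb a"
      have "real (card (P k)) - real (card {z. {a, y, z} \<in> E}) \<le> real (card (P k - {z. {a, y, z} \<in> E}))"
        by (rule real_card_Diff_ge[OF finite_conbrs[OF unif]])
      moreover have "real (card {z. {a, y, z} \<in> E}) \<le> 14"
        by (rule codeg_small) (use y P_subset in auto)
      ultimately show "n / 6 \<le> real (card (P k - {z. {a, y, z} \<in> E}))"
        using part_ge[OF k(1)] n_large by simp
    qed (use finP in auto)
    moreover have "n / 1000 * (n / 6) \<le> real (card (P j - nb a)) * (n / 6)"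
      using j(3) n_pos by (intro mult_right_mono) auto
    moreover have "S \<subseteq> link M a"
      unfolding S_def link_def M_def using HE j(2) k(2,3) aV
      by (auto simp: triple_in_full_iff part_def)
    then have "real (card S) \<le> real (card (link M a))"
      by (rule real_card_mono[OF finite_link[OF uM]])
    ultimately show ?thesis unfolding card_link[OF uM] by (simp add: power2_eq_square)
  qed
  have "real (card bad) * (n\<^sup>2 / 6000) = (\<Sum>a\<in>bad. n\<^sup>2 / 6000)" by simp
  also have "\<dots> \<le> (\<Sum>a\<in>bad. 2 * real (degree M a))" by (rule sum_mono) (rule d)
  also have "\<dots> \<le> (\<Sum>a\<in>V. 2 * real (degree M a))"
    by (rule sum_mono2) (use finV in \<open>auto simp: bad_def\<close>)
  also have "\<dots> = 6 * real (card M)"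
    using arg_cong[OF sum_degree[OF uM], of real] by (simp add: sum_distrib_left[symmetric])
  also have "\<dots> \<le> n\<^sup>2 / 6000 * (36000 / 10 ^ 9 * n)"
    using card_M by (simp add: power2_eq_square power3_eq_cube)
  finally have "n\<^sup>2 / 6000 * real (card bad) \<le> n\<^sup>2 / 6000 * (36000 / 10 ^ 9 * n)"
    by (simp add: mult.commute)
  then have "real (card bad) \<le> 36000 / 10 ^ 9 * n" using n_pos by simp
  then show ?thesis using n_pos by simp
qed

lemma card_not_nb: "a \<in> V \<Longrightarrow> a \<notin> bad \<Longrightarrow> j < 5 \<Longrightarrow> j \<noteq> f a \<Longrightarrow> real (card (P j - nb a)) \<le> n / 1000"
  unfolding bad_def by force

section \<open>Home colours of vertices of large degree\<close>

definition typical :: "'a \<Rightarrow> ('a \<times> 'a) set" where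
  "typical v = {(x, y) \<in> link E v. x \<notin> bad \<and> y \<notin> bad \<and> x \<in> nb v \<and> y \<in> nb v}"

text \<open>Discarded are at most \<open>2 * n * card bad\<close> pairs with a bad end and
  \<open>28 * n\<close> pairs with an end of small codegree; the step from 0.479 to 0.478 pays for
  both.\<close>

lemma card_typical:
  assumes "2 * real (degree E v) \<ge> (12 / 25 - 1 / 1000) * n\<^sup>2"
  shows "478 / 1000 * n\<^sup>2 \<le> real (card (typical v))"
proof -
  define S where "S = Sigma (V - nb v) (\<lambda>x. {y. {v, x, y} \<in> E})"
  define B where "B = bad \<times> V"
  have fin: "finite S" "finite B" "finite (typical v)"
    unfolding S_def B_def typical_def
    using finV fin_bad finite_conbrs[OF unif] finite_link[OF unif]
    by (auto intro: finite_subset[of _ "link E v"])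
  have "real (card S) \<le> real (card (V - nb v)) * 14"
    unfolding S_def by (rule real_card_Sigma_le) (use finV finite_conbrs[OF unif] codeg_small in auto)
  moreover have "real (card (V - nb v)) \<le> n" unfolding n_def by (rule real_card_mono) (use finV in auto)
  ultimately have S: "real (card S) \<le> 14 * n" by linarith
  have "real (card B) = real (card bad) * n" unfolding B_def n_def by (simp add: card_cartesian_product)
  also have "\<dots> \<le> n / 10 ^ 4 * n" using card_bad n_pos by (intro mult_right_mono) auto
  finally have B: "real (card B) \<le> n\<^sup>2 / 10 ^ 4" by (simp add: power2_eq_square)
  have "link E v \<subseteq> typical v \<union> ((B \<union> B\<inverse>) \<union> (S \<union> S\<inverse>))"
  proof (rule subrelI)
    fix x y assume xy: "(x, y) \<in> link E v"
    then have "{v, x, y} \<in> E" "{v, y, x} \<in> E" by (auto simp: link_def insert_commute)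
    with xy subsetD[OF link_subset[OF unif] xy]
    show "(x, y) \<in> typical v \<union> ((B \<union> B\<inverse>) \<union> (S \<union> S\<inverse>))"
      unfolding typical_def S_def B_def by auto
  qed
  then have "real (card (link E v)) \<le> real (card (typical v \<union> ((B \<union> B\<inverse>) \<union> (S \<union> S\<inverse>))))"
    by (rule real_card_mono[rotated]) (use fin in auto)
  also have "\<dots> \<le> real (card (typical v)) + ((real (card B) + real (card B)) + (real (card S) + real (card S)))"
    using card_inverse[of B] card_inverse[of S]
    by (intro order_trans[OF real_card_Un_le] add_left_mono add_mono order_trans[OF real_card_Un_le]) auto
  finally have "(12 / 25 - 1 / 1000) * n\<^sup>2 \<le> real (card (typical v)) + 2 * (n\<^sup>2 / 10 ^ 4) + 28 * n"
    using assms B S by (simp add: card_link[OF unif])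
  moreover have "28 * n \<le> 28 / 10 ^ 6 * n\<^sup>2"
    using mult_right_mono[OF n_large, of n] n_pos by (simp add: power2_eq_square)
  ultimately show ?thesis using n_pos by (simp add: algebra_simps)
qed

text \<open>In each of the three parts \<open>x\<close> and \<open>y\<close> miss at most
  \<open>n / 1000\<close> vertices each, so \<open>n / 250 - n / 500 = n / 500\<close> common
  neighbours remain.\<close>

lemma typical_blocked:
  assumes xy: "(x, y) \<in> typical v"
    and k: "{k1, k2, k3} \<subseteq> {..<5} - {f x, f y}" "k1 \<noteq> k2" "k1 \<noteq> k3" "k2 \<noteq> k3"
    and large: "\<And>k. k \<in> {k1, k2, k3} \<Longrightarrow> n / 250 \<le> real (card (P k \<inter> nb v))"
  shows False
proof (rule no_common_neighbours)
  show "{v, x, y} \<in> E" "{k1, k2, k3} \<subseteq> {..<5}" using xy k unfolding typical_def link_def by auto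
  show "k1 \<noteq> k2" "k1 \<noteq> k3" "k2 \<noteq> k3" by fact+
  have V: "x \<in> V" "y \<in> V" "x \<notin> bad" "y \<notin> bad"
    using xy link_subset[OF unif] unfolding typical_def by auto
  fix k assume k': "k \<in> {k1, k2, k3}"
  let ?Y = "{z \<in> P k. \<forall>u\<in>{v, x, y}. z \<in> nb u}"
  have "k < 5" "k \<noteq> f x" "k \<noteq> f y" using k' k(1) by auto
  then have "real (card (P k - nb x)) \<le> n / 1000" "real (card (P k - nb y)) \<le> n / 1000"
    using card_not_nb V by auto
  moreover have "P k \<inter> nb v \<subseteq> ?Y \<union> ((P k - nb x) \<union> (P k - nb y))" by auto
  then have "real (card (P k \<inter> nb v)) \<le> real (card (?Y \<union> ((P k - nb x) \<union> (P k - nb y))))"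
    by (rule real_card_mono[rotated]) (use finP in auto)
  moreover have "\<dots> \<le> real (card ?Y) + (real (card (P k - nb x)) + real (card (P k - nb y)))"
    by (intro order_trans[OF real_card_Un_le] add_left_mono real_card_Un_le)
  ultimately show "n / 500 \<le> real (card ?Y)" using large[OF k'] by linarith
qed

text \<open>\<open>I\<close> holds the colours in which \<open>v\<close> has almost no neighbours,
  and it turns out to be one colour, the home. If it were empty, three colours would be free to
  block any typical pair; two such colours, or a further colour with many non-neighbours, would
  leave too few typical pairs.\<close>

lemma home_exists:
  assumes "2 * real (degree E v) \<ge> (12 / 25 - 1 / 1000) * n\<^sup>2"
  shows "\<exists>i<5. \<forall>j<5. j \<noteq> i \<longrightarrow> real (card (P j - nb v)) \<le> n / 25"
proof -
  note many_typical = card_typical[OF assms]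
  define I where "I = {k. k < 5 \<and> real (card (P k \<inter> nb v)) < n / 250}"
  have n2: "n\<^sup>2 > 0" using n_pos by simp
  have outI: "n / 250 \<le> real (card (P k \<inter> nb v))" if "k < 5" "k \<notin> I" for k
    using that unfolding I_def by auto
  have typV: "x \<in> V" "y \<in> V" "x \<in> nb v" "y \<in> nb v" "f x < 5" "f y < 5" if "(x, y) \<in> typical v" for x y
    using that link_subset[OF unif] col unfolding typical_def by auto
  define D where "D i = (P i \<inter> nb v) \<times> V" for i
  have fD: "finite (D i)" for i unfolding D_def using finP finV by auto
  have cD: "real (card (D i \<union> (D i)\<inverse>)) \<le> n\<^sup>2 / 125" if "i \<in> I" for i
  proof -
    have "real (card (D i)) = real (card (P i \<inter> nb v)) * n"
      unfolding D_def n_def by (simp add: card_cartesian_product)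
    also have "\<dots> \<le> n / 250 * n" using that n_pos unfolding I_def by (intro mult_right_mono) auto
    finally have "real (card (D i)) \<le> n\<^sup>2 / 250" by (simp add: power2_eq_square)
    moreover have "real (card ((D i)\<inverse>)) = real (card (D i))" by (simp add: card_inverse)
    ultimately show ?thesis using real_card_Un_le[of "D i" "(D i)\<inverse>"] by linarith
  qed
  have not_empty: "I \<noteq> {}"
  proof
    assume I: "I = {}"
    have "typical v \<noteq> {}" using many_typical n2 by auto
    then obtain x y where xy: "(x, y) \<in> typical v" by auto
    have "card {f x, f y} \<le> 2" by (simp add: card_insert_if)
    then obtain k1 k2 k3 where "{k1, k2, k3} \<subseteq> {..<5} - {f x, f y}" "k1 \<noteq> k2" "k1 \<noteq> k3" "k2 \<noteq> k3"
      using three_other_colours[of "{f x, f y}"] by auto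
    then show False using typical_blocked[OF xy] outI I by blast
  qed
  have single: "j = i" if ij: "i \<in> I" "j \<in> I" for i j
  proof (rule ccontr)
    assume ne: "j \<noteq> i"
    have lt: "i < 5" "j < 5" using ij unfolding I_def by auto
    define W where "W = V - (P i \<union> P j)"
    have fW: "finite W" unfolding W_def using finV by auto
    have "card (P i \<union> P j) = card (P i) + card (P j)"
      by (rule card_Un_disjoint) (use finP ne in \<open>auto simp: part_def\<close>)
    moreover have "card W = card V - card (P i \<union> P j)" "card (P i \<union> P j) \<le> card V"
      unfolding W_def using finP P_subset finV
      by (auto intro!: card_Diff_subset card_mono)
    ultimately have "real (card W) = n - real (card (P i)) - real (card (P j))"
      unfolding n_def by (simp add: of_nat_diff)
    then have W: "real (card W) \<le> 601 / 1000 * n"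
      using part_ge[OF lt(1)] part_ge[OF lt(2)] n_pos by linarith
    have "typical v \<subseteq> ((D i \<union> (D i)\<inverse>) \<union> (D j \<union> (D j)\<inverse>)) \<union> W \<times> W"
    proof (rule subrelI)
      fix x y assume xy: "(x, y) \<in> typical v"
      show "(x, y) \<in> ((D i \<union> (D i)\<inverse>) \<union> (D j \<union> (D j)\<inverse>)) \<union> W \<times> W"
        using typV[OF xy] unfolding D_def W_def by auto
    qed
    then have "real (card (typical v)) \<le> real (card (((D i \<union> (D i)\<inverse>) \<union> (D j \<union> (D j)\<inverse>)) \<union> W \<times> W))"
      by (rule real_card_mono[rotated]) (use fD fW in auto)
    also have "\<dots> \<le> (n\<^sup>2 / 125 + n\<^sup>2 / 125) + real (card (W \<times> W))"
      by (intro order_trans[OF real_card_Un_le] add_right_mono add_mono cD ij)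
    also have "real (card (W \<times> W)) \<le> (601 / 1000 * n) * (601 / 1000 * n)"
      unfolding card_cartesian_product of_nat_mult using W n_pos by (intro mult_mono) auto
    \<comment> \<open>Three parts carry too few pairs: 0.016 + 0.601^2 = 0.377201 is below
      0.478.\<close>
    finally show False using many_typical n2 by (simp add: power2_eq_square)
  qed
  obtain i where i: "i \<in> I" using not_empty by blast
  then have i5: "i < 5" unfolding I_def by auto
  have "real (card (P j - nb v)) \<le> n / 25" if j: "j < 5" "j \<noteq> i" for j
  proof (rule ccontr)
    assume large: "\<not> ?thesis"
    define W where "W = V - P i"
    define N where "N = W \<inter> nb v"
    have fW: "finite W" "finite N" unfolding W_def N_def using finV by auto
    have sub: "P i \<union> (P j - nb v) \<subseteq> V" using P_subset by auto
    have "card (P i \<union> (P j - nb v)) = card (P i) + card (P j - nb v)"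
      by (rule card_Un_disjoint) (use finP j in \<open>auto simp: part_def\<close>)
    moreover have "card (V - (P i \<union> (P j - nb v))) = card V - card (P i \<union> (P j - nb v))"
      "card (P i \<union> (P j - nb v)) \<le> card V"
      using sub finV finP by (auto intro!: card_Diff_subset card_mono)
    ultimately have "real (card (V - (P i \<union> (P j - nb v)))) = n - real (card (P i)) - real (card (P j - nb v))"
      unfolding n_def by (simp add: of_nat_diff)
    moreover have "real (card N) \<le> real (card (V - (P i \<union> (P j - nb v))))"
      unfolding N_def W_def by (rule real_card_mono) (use finV in auto)
    ultimately have N: "real (card N) \<le> 761 / 1000 * n"
      using part_ge[OF i5] large n_pos by linarith
    define T where "T = Sigma N (\<lambda>x. W - P (f x))"
    have fT: "finite T" unfolding T_def using fW by auto
    have "real (card T) \<le> real (card N) * (601 / 1000 * n)"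
      unfolding T_def
    proof (rule real_card_Sigma_le)
      fix x assume "x \<in> N"
      then have x: "x \<in> V" "f x \<noteq> i" "f x < 5" using col unfolding N_def W_def part_def by auto
      have "card (P i \<union> P (f x)) = card (P i) + card (P (f x))"
        by (rule card_Un_disjoint) (use finP x in \<open>auto simp: part_def\<close>)
      moreover have "card (V - (P i \<union> P (f x))) = card V - card (P i \<union> P (f x))"
        "card (P i \<union> P (f x)) \<le> card V"
        using finP P_subset finV by (auto intro!: card_Diff_subset card_mono)
      ultimately have "real (card (V - (P i \<union> P (f x)))) = n - real (card (P i)) - real (card (P (f x)))"
        unfolding n_def by (simp add: of_nat_diff)
      moreover have "W - P (f x) = V - (P i \<union> P (f x))" unfolding W_def by auto
      ultimately show "real (card (W - P (f x))) \<le> 601 / 1000 * n"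
        using part_ge[OF i5] part_ge[OF x(3)] n_pos by simp
    qed (use fW in auto)
    also have "\<dots> \<le> 761 / 1000 * n * (601 / 1000 * n)" using N n_pos by (intro mult_right_mono) auto
    finally have T: "real (card T) \<le> 761 / 1000 * n * (601 / 1000 * n)" .
    have "typical v \<subseteq> (D i \<union> (D i)\<inverse>) \<union> T"
    proof (rule subrelI)
      fix x y assume xy: "(x, y) \<in> typical v"
      show "(x, y) \<in> (D i \<union> (D i)\<inverse>) \<union> T"
      proof (cases "f x = i \<or> f y = i")
        case True
        then show ?thesis using typV[OF xy] unfolding D_def part_def by auto
      next
        case False
        \<comment> \<open>A monochromatic pair occupies only one colour besides \<open>i\<close>, so
          three colours outside \<open>I\<close> are left to block it.\<close>
        have "f x \<noteq> f y"
        proof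
          assume eq: "f x = f y"
          have "card {i, f x} \<le> 2" by (simp add: card_insert_if)
          then obtain k1 k2 k3 where k: "{k1, k2, k3} \<subseteq> {..<5} - {i, f x}" "k1 \<noteq> k2" "k1 \<noteq> k3" "k2 \<noteq> k3"
            using three_other_colours[of "{i, f x}"] by auto
          show False
          proof (rule typical_blocked[OF xy _ k(2-4)])
            show "{k1, k2, k3} \<subseteq> {..<5} - {f x, f y}" using k eq by auto
            fix k assume "k \<in> {k1, k2, k3}"
            then show "n / 250 \<le> real (card (P k \<inter> nb v))" using k single[OF i] by (intro outI) auto
          qed
        qed
        then show ?thesis using False typV[OF xy] unfolding T_def N_def W_def part_def by auto
      qed
    qed
    then have "real (card (typical v)) \<le> real (card ((D i \<union> (D i)\<inverse>) \<union> T))"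
      by (rule real_card_mono[rotated]) (use fD fT in auto)
    also have "\<dots> \<le> n\<^sup>2 / 125 + 761 / 1000 * n * (601 / 1000 * n)"
      by (intro order_trans[OF real_card_Un_le] add_mono cD i T)
    \<comment> \<open>Here 0.008 + 0.761 * 0.601 = 0.465361, again below 0.478.\<close>
    finally show False using many_typical n2 by (simp add: power2_eq_square)
  qed
  then show ?thesis using i5 by blast
qed

text \<open>Recolour every vertex by its home. If two vertices of an edge shared a home, three
  colours would be foreign to all of its vertices, and in each the edge would have about
  \<open>n / 5 - 3 * n / 25\<close> common neighbours.\<close>

lemma rainbow_high_degree:
  "\<exists>h. rainbow V h {e \<in> E. \<forall>v\<in>e. 2 * real (degree E v) \<ge> (12 / 25 - 1 / 1000) * n\<^sup>2}"
proof -
  define good where "good v \<longleftrightarrow> 2 * real (degree E v) \<ge> (12 / 25 - 1 / 1000) * n\<^sup>2" for v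
  \<comment> \<open>Vertices of smaller degree get some colour below 5, so that \<open>h\<close>
    colours all of \<open>V\<close>.\<close>
  define h where "h v = (SOME i. i < 5 \<and>
    (good v \<longrightarrow> (\<forall>j<5. j \<noteq> i \<longrightarrow> real (card (P j - nb v)) \<le> n / 25)))" for v
  have "\<exists>i. i < 5 \<and> (good v \<longrightarrow> (\<forall>j<5. j \<noteq> i \<longrightarrow> real (card (P j - nb v)) \<le> n / 25))" for v
    using home_exists[of v] unfolding good_def by (cases "good v") (auto simp: good_def intro: exI[of _ 0])
  then have h: "h v < 5" "good v \<Longrightarrow> j < 5 \<Longrightarrow> j \<noteq> h v \<Longrightarrow> real (card (P j - nb v)) \<le> n / 25" for v j
    using someI_ex[of "\<lambda>i. i < 5 \<and> (good v \<longrightarrow> (\<forall>j<5. j \<noteq> i \<longrightarrow> real (card (P j - nb v)) \<le> n / 25))"]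
    unfolding h_def[symmetric] by blast+
  have "inj_on h e" if e: "e \<in> E" "\<And>v. v \<in> e \<Longrightarrow> good v" for e
  proof (rule ccontr)
    assume "\<not> inj_on h e"
    moreover have e3: "card e = 3" "finite e"
      using e(1) unif finite_subset[OF _ finV] unfolding uniform3_def by auto
    ultimately have "card (h ` e) \<noteq> 3" using eq_card_imp_inj_on by fastforce
    then have "card (h ` e) \<le> 2" using card_image_le[OF e3(2), of h] e3(1) by linarith
    then obtain k1 k2 k3 where k: "{k1, k2, k3} \<subseteq> {..<5} - h ` e" "k1 \<noteq> k2" "k1 \<noteq> k3" "k2 \<noteq> k3"
      using three_other_colours[of "h ` e"] e3(2) by auto
    show False
    proof (rule no_common_neighbours[OF e(1) _ k(2-4)])
      show "{k1, k2, k3} \<subseteq> {..<5}" using k by auto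
      fix j assume "j \<in> {k1, k2, k3}"
      then have j: "j < 5" "j \<notin> h ` e" using k by auto
      let ?Y = "{y \<in> P j. \<forall>x\<in>e. y \<in> nb x}"
      have "P j \<subseteq> ?Y \<union> (\<Union>x\<in>e. P j - nb x)" by auto
      then have "real (card (P j)) \<le> real (card (?Y \<union> (\<Union>x\<in>e. P j - nb x)))"
        by (rule real_card_mono[rotated]) (use finP e3 in auto)
      also have "\<dots> \<le> real (card ?Y) + real (card (\<Union>x\<in>e. P j - nb x))" by (rule real_card_Un_le)
      also have "real (card (\<Union>x\<in>e. P j - nb x)) \<le> real (\<Sum>x\<in>e. card (P j - nb x))"
        using card_UN_le[OF e3(2), of "\<lambda>x. P j - nb x"] by (rule of_nat_mono)
      also have "\<dots> = (\<Sum>x\<in>e. real (card (P j - nb x)))" by simp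
      also have "\<dots> \<le> (\<Sum>x\<in>e. n / 25)"
        by (rule sum_mono) (use h(2) e(2) j in \<open>auto simp: image_iff\<close>)
      also have "\<dots> = 3 * n / 25" using e3 by simp
      finally show "n / 500 \<le> real (card ?Y)" using part_ge[OF j(1)] n_pos by simp
    qed
  qed
  then have "rainbow V h {e \<in> E. \<forall>v\<in>e. good v}" using h(1) unfolding rainbow_def by auto
  then show ?thesis unfolding good_def by blast
qed

end

section \<open>Stability\<close>

text \<open>The threshold is the one above which \<open>home_exists\<close> provides a home.\<close>

definition low :: "'a set \<Rightarrow> 'a set set \<Rightarrow> 'a set" where
  "low V E = {v \<in> V. 2 * real (degree E v) < (12 / 25 - 1 / 1000) * (real (card V))\<^sup>2}"

text \<open>Deleting \<open>z\<close> vertices lowers the extremal bound by about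
  \<open>6 / 25 * z * n\<^sup>2\<close>, but \<open>z\<close> low vertices take away
  \<open>z * n\<^sup>2 / 2000\<close> fewer edges. Too many of them would leave a hypergraph
  violating \<open>cross_sparse_card_le\<close>.\<close>

lemma card_low:
  assumes E: "uniform3 V E" "cross_sparse 1 E" and large: "real (card V) \<ge> 10 ^ 10"
    and dense: "real (card E) \<ge> (2 / 25 - 1 / 10 ^ 13) * real (card V) ^ 3"
  shows "real (card (low V E)) \<le> real (card V) / 10 ^ 9"
proof (rule ccontr)
  assume many: "\<not> ?thesis"
  define n where "n = real (card V)"
  have finV: "finite V" using E(1) by (rule uniform3_finite)
  have n: "n \<ge> 10 ^ 10" "n > 0" using large unfolding n_def by auto
  \<comment> \<open>The gain is linear in \<open>z\<close> and the error quadratic, so only about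
    \<open>n / 10 ^ 9\<close> low vertices are deleted, however many there are.\<close>
  define z where "z = Suc (card V div 10 ^ 9)"
  have zl: "n / 10 ^ 9 \<le> real z" and zu: "real z \<le> 2 * n / 10 ^ 9"
  proof -
    have "real (card V div 10 ^ 9) \<le> n / 10 ^ 9" unfolding n_def
      using of_nat_div_le_of_nat[of "card V" "10 ^ 9", where ?'a = real] by simp
    then show "real z \<le> 2 * n / 10 ^ 9" using n unfolding z_def by simp
    have "card V < z * 10 ^ 9" unfolding z_def using dividend_less_div_times[of "10 ^ 9" "card V"] by simp
    then have "real (card V) \<le> real (z * 10 ^ 9)" by (intro of_nat_mono) simp
    then show "n / 10 ^ 9 \<le> real z" unfolding n_def by simp
  qed
  have "real (card V div 10 ^ 9) < real (card (low V E))"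
    using many of_nat_div_le_of_nat[of "card V" "10 ^ 9", where ?'a = real] by simp
  then have "z \<le> card (low V E)" unfolding z_def by simp
  then obtain Z where Z: "Z \<subseteq> low V E" "card Z = z" by (metis obtain_subset_with_card_n)
  have ZV: "Z \<subseteq> V" "finite Z" using Z(1) finite_subset[OF _ finV, of Z] unfolding low_def by auto
  define E1 where "E1 = {e \<in> E. e \<inter> Z = {}}"
  have u1: "uniform3 (V - Z) E1" using E(1) unfolding E1_def uniform3_def by auto
  have cV: "real (card (V - Z)) = n - real z"
    using card_Diff_subset[OF ZV(2,1)] card_mono[OF finV ZV(1)] Z(2) unfolding n_def
    by (simp add: of_nat_diff)
  have "real (card E1) \<le> 2 / 25 * real (card (V - Z)) ^ 3"
  proof (rule cross_sparse_card_le[OF u1])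
    show "cross_sparse 1 E1" by (rule cross_sparse_subset[OF E]) (auto simp: E1_def)
    have "real (card (V - Z)) \<ge> 2000" unfolding cV using n zu by simp
    then show "2000 \<le> card (V - Z)" by simp
  qed
  moreover have "real (card E) \<le> real (card E1) + (\<Sum>v\<in>Z. real (degree E v))"
    using of_nat_mono[OF card_edges_avoiding_ge[OF E(1) ZV(1)], where 'a = real]
    unfolding E1_def by simp
  moreover have "(\<Sum>v\<in>Z. real (degree E v)) \<le> (\<Sum>v\<in>Z. (6 / 25 - 1 / 2000) * n\<^sup>2)"
    by (rule sum_mono) (use Z(1) in \<open>auto simp: low_def n_def\<close>)
  ultimately have "(2 / 25 - 1 / 10 ^ 13) * n ^ 3 \<le> 2 / 25 * (n - real z) ^ 3 + real z * ((6 / 25 - 1 / 2000) * n\<^sup>2)"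
    using dense unfolding cV by (simp add: Z(2) n_def[symmetric])
  then have "real z * n\<^sup>2 / 2000 + 2 / 25 * real z ^ 3 \<le> n ^ 3 / 10 ^ 13 + 6 / 25 * (n * (real z)\<^sup>2)"
    by (simp add: power2_eq_square power3_eq_cube algebra_simps)
  moreover have "n ^ 3 / (2 * 10 ^ 12) \<le> real z * n\<^sup>2 / 2000"
    using mult_right_mono[OF zl, of "n\<^sup>2"] n(2) by (simp add: power2_eq_square power3_eq_cube)
  moreover have "n * (real z)\<^sup>2 \<le> n ^ 3 / 10 ^ 14"
  proof -
    have "(real z)\<^sup>2 \<le> (2 * n / 10 ^ 9)\<^sup>2" using zu by (intro power_mono) auto
    also have "\<dots> \<le> n\<^sup>2 / 10 ^ 14" by (simp add: power_divide power_mult_distrib)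
    finally have "n * (real z)\<^sup>2 \<le> n * (n\<^sup>2 / 10 ^ 14)" using n(2) by (intro mult_left_mono) auto
    then show ?thesis by (simp add: power2_eq_square power3_eq_cube)
  qed
  moreover have "0 \<le> real z ^ 3" by simp
  ultimately have "n ^ 3 / (2 * 10 ^ 12) \<le> n ^ 3 / 10 ^ 13 + 6 / 25 * (n ^ 3 / 10 ^ 14)" by linarith
  then show False using n(2) by simp
qed

text \<open>The additional vertex \<open>v\<close> is the one whose edges a cloning step replaced.
  Each avoided vertex costs at most \<open>n\<^sup>2 / 2\<close> edges.\<close>

lemma dense_avoiding_low:
  assumes E: "uniform3 V E" "cross_sparse 1 E" and large: "real (card V) \<ge> 10 ^ 10"
    and dense: "real (card E) \<ge> (2 / 25 - 1 / 10 ^ 13) * real (card V) ^ 3"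
  shows "(2 / 25 - 1 / 10 ^ 9) * real (card V) ^ 3 \<le> real (card {e \<in> E. e \<inter> insert v (low V E) = {}})"
proof -
  define n where "n = real (card V)"
  define Z where "Z = insert v (low V E) \<inter> V"
  have finV: "finite V" using E(1) by (rule uniform3_finite)
  have n: "n \<ge> 10 ^ 10" "n > 0" using large unfolding n_def by auto
  have eq: "{e \<in> E. e \<inter> insert v (low V E) = {}} = {e \<in> E. e \<inter> Z = {}}"
    using E(1) unfolding Z_def uniform3_def by blast
  have fl: "finite (low V E)" using finV unfolding low_def by auto
  then have "card Z \<le> card (insert v (low V E))" unfolding Z_def by (intro card_mono) auto
  also have "\<dots> \<le> Suc (card (low V E))" using fl by (simp add: card_insert_if)
  finally have "real (card Z) \<le> n / 10 ^ 9 + 1"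
    using card_low[OF assms] unfolding n_def by linarith
  then have "real (card Z) * (n\<^sup>2 / 2) \<le> (n / 10 ^ 9 + 1) * (n\<^sup>2 / 2)"
    by (intro mult_right_mono) auto
  moreover have "(\<Sum>v\<in>Z. real (degree E v)) \<le> (\<Sum>v\<in>Z. n\<^sup>2 / 2)"
  proof (rule sum_mono)
    fix v
    have "real (2 * degree E v) \<le> real ((card V)\<^sup>2)" by (rule of_nat_mono) (rule degree_le[OF E(1)])
    then show "real (degree E v) \<le> n\<^sup>2 / 2" unfolding n_def by simp
  qed
  moreover have "real (card E) \<le> real (card {e \<in> E. e \<inter> Z = {}}) + (\<Sum>v\<in>Z. real (degree E v))"
    using of_nat_mono[OF card_edges_avoiding_ge[OF E(1), of Z], where 'a = real]
    unfolding Z_def by simp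
  ultimately have main: "(2 / 25 - 1 / 10 ^ 13) * n ^ 3 \<le> real (card {e \<in> E. e \<inter> Z = {}}) + (n / 10 ^ 9 + 1) * (n\<^sup>2 / 2)"
    using dense unfolding n_def[symmetric] sum_constant by linarith
  have sq: "n\<^sup>2 \<le> n ^ 3 / 10 ^ 10"
    using mult_right_mono[OF n(1), of "n\<^sup>2"] by (simp add: power2_eq_square power3_eq_cube)
  show ?thesis
  proof -
    have "(n / 10 ^ 9 + 1) * (n\<^sup>2 / 2) = n ^ 3 / (2 * 10 ^ 9) + n\<^sup>2 / 2"
      by (simp add: power2_eq_square power3_eq_cube field_simps)
    with main have "(2 / 25 - 1 / 10 ^ 13) * n ^ 3 \<le>
        real (card {e \<in> E. e \<inter> Z = {}}) + (n ^ 3 / (2 * 10 ^ 9) + n\<^sup>2 / 2)" by (simp only:)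
    moreover have "n ^ 3 \<ge> 0" using n(2) by simp
    moreover have "(2 / 25 - 1 / 10 ^ 9) * c \<le> a"
      if "(2 / 25 - 1 / 10 ^ 13) * c \<le> a + (c / (2 * 10 ^ 9) + s / 2)" "c \<ge> 0" "s \<le> c / 10 ^ 10"
      for a c s :: real
      using that by simp
    ultimately show ?thesis using sq unfolding eq n_def[symmetric] by blast
  qed
qed

lemma avoiding_low_iff:
  assumes "uniform3 V E" "e \<in> E"
  shows "e \<inter> low V E = {} \<longleftrightarrow> (\<forall>v\<in>e. 2 * real (degree E v) \<ge> (12 / 25 - 1 / 1000) * (real (card V))\<^sup>2)"
proof -
  have "e \<subseteq> V" using assms unfolding uniform3_def by auto
  then show ?thesis unfolding low_def disjoint_iff by (auto simp: not_less subset_iff)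
qed

text \<open>Undoing one symmetrization step changes only the edges at one vertex, so what remains is still
  dense and rainbow. The extension argument yields an exact colouring of the vertices of large
  degree, hence no error accumulates along the way.\<close>

lemma stability:
  assumes "uniform3 V E" "cross_sparse 1 E" and large: "real (card V) \<ge> 10 ^ 10"
    and "real (card E) \<ge> (2 / 25 - 1 / 10 ^ 13) * real (card V) ^ 3"
  shows "\<exists>f. rainbow V f {e \<in> E. e \<inter> low V E = {}}"
  using assms(1,2,4)
proof (induction rule: symmetrization_induct)
  case (symmetrized E)
  have "(799 / 10000) * real (card V) ^ 3 \<le> (2 / 25 - 1 / 10 ^ 13) * real (card V) ^ 3"
    by (rule mult_right_mono) auto
  then obtain f where "rainbow V f E"
    using symmetrized_rainbow[OF symmetrized(1,2)] symmetrized(3) large by fastforce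
  then have "rainbow V f {e \<in> E. e \<inter> low V E = {}}" unfolding rainbow_def by auto
  then show ?case by blast
next
  case (step E u v)
  let ?E = "clone V E u v"
  note u' = uniform3_clone[OF step(1), of u v] and s' = cross_sparse_clone[OF step(1,2), of u v]
  have dense': "real (card ?E) \<ge> (2 / 25 - 1 / 10 ^ 13) * real (card V) ^ 3"
    using step.prems step(5) by linarith
  then obtain f where f: "rainbow V f {e \<in> ?E. e \<inter> low V ?E = {}}" using step.IH by blast
  define H where "H = {e \<in> ?E. e \<inter> insert v (low V ?E) = {}}"
  interpret dense_rainbow V E H f "real (card V)"
  proof
    show "uniform3 V E" "cross_sparse 15 E" using step cross_sparse_mono[OF step(2)] by auto
    show "H \<subseteq> E" unfolding H_def using clone_iff_avoiding[OF step(1)] by auto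
    show "rainbow V f H" using f unfolding H_def rainbow_def by auto
    show "(2 / 25 - 1 / 10 ^ 9) * real (card V) ^ 3 \<le> real (card H)"
      unfolding H_def by (rule dense_avoiding_low[OF u' s' large dense'])
  qed (use large in auto)
  have "{e \<in> E. e \<inter> low V E = {}} =
      {e \<in> E. \<forall>v\<in>e. 2 * real (degree E v) \<ge> (12 / 25 - 1 / 1000) * (real (card V))\<^sup>2}"
    using avoiding_low_iff[OF step(1)] by blast
  then show ?case using rainbow_high_degree by simp
qed

text \<open>In the potential argument \<open>ok\<close> allows \<open>m\<close> deleted edges per
  pair that became uncovered. In a smallest admissible \<open>F\<close> every covered pair has
  codegree above \<open>m\<close>, since otherwise its edges could be deleted too. Thus pairs of
  codegree at most \<open>m\<close> in \<open>E\<close> are uncovered in \<open>F\<close>.\<close>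

lemma cleaning:
  assumes E: "uniform3 V E" "cross_sparse (Suc m) E"
  shows "\<exists>F\<subseteq>E. cross_sparse 1 F \<and> card E \<le> card F + m * (card V)\<^sup>2"
proof -
  define shadow where "shadow F = {(u, v). 0 < codeg F u v}" for F :: "'a set set"
  have finV: "finite V" and finE: "finite E"
    using uniform3_finite[OF E(1)] uniform3_finite_edges[OF E(1)] by auto
  have sub: "shadow F \<subseteq> V \<times> V" if F: "F \<subseteq> E" for F
  proof (rule subrelI)
    fix u v assume "(u, v) \<in> shadow F"
    then obtain w where "{u, v, w} \<in> E"
      using codeg_pos_iff[OF uniform3_subset[OF E(1) F]] F unfolding shadow_def by blast
    then show "(u, v) \<in> V \<times> V" using uniform3_triple[OF E(1)] by blast
  qed
  have fin: "finite (shadow F)" if "F \<subseteq> E" for F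
    using finite_subset[OF sub[OF that]] finV by simp
  define ok where "ok F \<longleftrightarrow> F \<subseteq> E \<and> card E + m * card (shadow F) \<le> card F + m * card (shadow E)" for F
  have "ok E" unfolding ok_def by simp
  then obtain F where F: "ok F" and min: "\<And>F'. ok F' \<Longrightarrow> card F \<le> card F'"
    using ex_has_least_nat[of ok E card] by blast
  have FE: "F \<subseteq> E" and uF: "uniform3 V F" using F uniform3_subset[OF E(1)] unfolding ok_def by auto
  have large: "m < codeg F u v" if pos: "0 < codeg F u v" for u v
  proof (rule ccontr)
    assume small: "\<not> m < codeg F u v"
    define D where "D = {e \<in> F. u \<in> e \<and> v \<in> e}"
    have finF: "finite F" using FE finE finite_subset by blast
    have ne: "u \<noteq> v" using pos codeg_same[OF uF] by auto
    have cD: "card D = codeg F u v" unfolding D_def by (rule card_common_edges[OF uF ne])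
    have cF: "card F = card (F - D) + card D"
      using card_Diff_subset[of D F] card_mono[OF finF, of D] finF by (auto simp: D_def)
    have "(u, v) \<in> shadow F" using pos unfolding shadow_def by simp
    moreover have "(u, v) \<notin> shadow (F - D)"
    proof -
      have "{u, v, w} \<notin> F - D" for w unfolding D_def by auto
      then have "{w. {u, v, w} \<in> F - D} = {}" by blast
      then have "codeg (F - D) u v = 0" unfolding codeg_def by (simp only: card.empty)
      then show ?thesis unfolding shadow_def by simp
    qed
    moreover have "shadow (F - D) \<subseteq> shadow F"
      unfolding shadow_def using codeg_mono[OF uF, of "F - D"] by (auto intro: less_le_trans)
    ultimately have "shadow (F - D) \<subset> shadow F" by auto
    then have lt: "card (shadow (F - D)) < card (shadow F)" by (rule psubset_card_mono[OF fin[OF FE]])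
    have "m * card (shadow (F - D)) + m \<le> m * card (shadow F)"
      using lt by (metis Suc_leI add.commute mult_Suc_right mult_le_mono2)
    then have "ok (F - D)" using F FE cF cD small unfolding ok_def by auto
    from min[OF this] show False using cF cD pos by simp
  qed
  have "cross_sparse 1 F"
    unfolding cross_sparse_def
  proof (intro ballI)
    fix X Y assume "X \<in> F" "Y \<in> F"
    then obtain x y where xy: "x \<in> X" "y \<in> Y" "codeg E x y < Suc m"
      using E(2) FE unfolding cross_sparse_def by blast
    then have "codeg F x y = 0" using large[of x y] codeg_mono[OF E(1) FE, of x y] by fastforce
    then show "\<exists>x\<in>X. \<exists>y\<in>Y. codeg F x y < 1" using xy by auto
  qed
  moreover have "card (shadow E) \<le> (card V)\<^sup>2"
    using card_mono[OF _ sub[of E]] finV by (simp add: card_cartesian_product power2_eq_square)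
  then have "m * card (shadow E) \<le> m * (card V)\<^sup>2" by (rule mult_le_mono2)
  then have "card E \<le> card F + m * (card V)\<^sup>2" using F unfolding ok_def by linarith
  ultimately show ?thesis using FE by blast
qed

text \<open>Stability is applied to the cleaned \<open>F\<close>, the extension argument to
  \<open>E\<close> itself. As all degrees in \<open>E\<close> are large, the new colouring is proper
  on the deleted edges as well.\<close>

theorem rainbow_of_large_degrees:
  assumes E: "uniform3 V E" "cross_sparse 15 E" and large: "real (card V) \<ge> 10 ^ 16"
    and dense: "real (card E) \<ge> (2 / 25 - 1 / (2 * 10 ^ 13)) * real (card V) ^ 3"
    and deg: "\<And>v. v \<in> V \<Longrightarrow> 2 * real (degree E v) \<ge> (12 / 25 - 1 / 1000) * (real (card V))\<^sup>2"
  shows "\<exists>h. rainbow V h E"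
proof -
  define n where "n = real (card V)"
  have "cross_sparse (Suc 14) E" using E(2) by (simp add: eval_nat_numeral)
  then obtain F where F: "F \<subseteq> E" "cross_sparse 1 F" "card E \<le> card F + 14 * (card V)\<^sup>2"
    using cleaning[OF E(1)] by blast
  have uF: "uniform3 V F" by (rule uniform3_subset[OF E(1) F(1)])
  have "real (card E) \<le> real (card F) + 14 * n\<^sup>2"
    using of_nat_mono[OF F(3), where 'a = real] unfolding n_def by simp
  \<comment> \<open>The lower bound on \<open>n\<close> lets the cost of cleaning fit into the
    difference of the two density tolerances.\<close>
  moreover have "14 * n\<^sup>2 \<le> n ^ 3 / (2 * 10 ^ 13)"
  proof -
    have "28 * 10 ^ 13 * n\<^sup>2 \<le> 10 ^ 16 * n\<^sup>2" by simp
    also have "\<dots> \<le> n * n\<^sup>2" using large unfolding n_def by (intro mult_right_mono) auto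
    finally show ?thesis by (simp add: power2_eq_square power3_eq_cube)
  qed
  ultimately have denseF: "real (card F) \<ge> (2 / 25 - 1 / 10 ^ 13) * real (card V) ^ 3"
    using dense unfolding n_def[symmetric] by (simp add: algebra_simps)
  have large': "real (card V) \<ge> 10 ^ 10" using large by simp
  obtain f where f: "rainbow V f {e \<in> F. e \<inter> low V F = {}}"
    using stability[OF uF F(2) large' denseF] by blast
  define H where "H = {e \<in> F. e \<inter> low V F = {}}"
  interpret dense_rainbow V E H f "real (card V)"
  proof
    show "uniform3 V E" "cross_sparse 15 E" by (fact E)+
    show "H \<subseteq> E" using F(1) unfolding H_def by auto
    show "rainbow V f H" using f unfolding H_def rainbow_def by auto
    show "(2 / 25 - 1 / 10 ^ 9) * real (card V) ^ 3 \<le> real (card H)"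
    proof -
      \<comment> \<open>No vertex was cloned here, so the additional vertex to avoid is
        arbitrary.\<close>
      fix v
      have "{e \<in> F. e \<inter> insert v (low V F) = {}} \<subseteq> H" unfolding H_def by auto
      then have "real (card {e \<in> F. e \<inter> insert v (low V F) = {}}) \<le> real (card H)"
        using uniform3_finite_edges[OF uF] by (intro real_card_mono) (auto simp: H_def)
      with dense_avoiding_low[OF uF F(2) large' denseF, of v] show ?thesis by linarith
    qed
  qed (use large in auto)
  have "{e \<in> E. \<forall>v\<in>e. 2 * real (degree E v) \<ge> (12 / 25 - 1 / 1000) * (real (card V))\<^sup>2} = E"
    using E(1) deg unfolding uniform3_def by blast
  then show ?thesis using rainbow_high_degree by simp
qed

section \<open>The exact result\<close>

lemma three_graph_iff: "three_graph G \<longleftrightarrow> uniform3 (verts G) (edges G)"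
  by (simp add: three_graph_def uniform3_def)

lemma turan_graph_verts: "verts (turan_graph n) = {..<n}"
  by (auto simp: turan_graph_def complete_multipartite_def residue_parts_def)

lemma turan_graph_edges: "edges (turan_graph n) = full {..<n} (\<lambda>v. v mod 5)"
proof (intro equalityI subsetI)
  fix e assume "e \<in> edges (turan_graph n)"
  then obtain a b c A B C where e: "e = {a, b, c}" and P: "A \<in> residue_parts n" "B \<in> residue_parts n"
    "C \<in> residue_parts n" and "A \<noteq> B" "A \<noteq> C" "B \<noteq> C" "a \<in> A" "b \<in> B" "c \<in> C"
    unfolding turan_graph_def complete_multipartite_def hypergraph.simps by blast
  then show "e \<in> full {..<n} (\<lambda>v. v mod 5)"
    unfolding e triple_in_full_iff residue_parts_def by auto
next
  fix e assume e: "e \<in> full {..<n} (\<lambda>v. v mod 5)"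
  then have "card e = 3" unfolding full_def by auto
  then obtain a b c where abc: "e = {a, b, c}" unfolding card_3_iff by blast
  let ?A = "\<lambda>x. {v. v < n \<and> v mod 5 = x mod (5::nat)}"
  have *: "a < n" "b < n" "c < n" "a mod 5 \<noteq> b mod 5" "a mod 5 \<noteq> c mod 5" "b mod 5 \<noteq> c mod 5"
    using e unfolding abc triple_in_full_iff by auto
  then have ne: "?A a \<noteq> ?A b" "?A a \<noteq> ?A c" "?A b \<noteq> ?A c" by blast+
  have P: "?A x \<in> residue_parts n" for x unfolding residue_parts_def by auto
  have "a \<in> ?A a" "b \<in> ?A b" "c \<in> ?A c" using * by auto
  with ne P have "\<exists>A\<in>residue_parts n. \<exists>B\<in>residue_parts n. \<exists>C\<in>residue_parts n.
      A \<noteq> B \<and> A \<noteq> C \<and> B \<noteq> C \<and> a \<in> A \<and> b \<in> B \<and> c \<in> C" by meson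
  then show "e \<in> edges (turan_graph n)"
    unfolding turan_graph_def complete_multipartite_def abc hypergraph.simps by blast
qed

lemma turan_graph_three_graph: "three_graph (turan_graph n)"
  unfolding three_graph_iff turan_graph_verts turan_graph_edges by (rule uniform3_full) simp

lemma mod5_col: "(\<lambda>v. v mod 5) ` {..<n} \<subseteq> {..<5::nat}" by auto

lemma residue_part_balanced:
  assumes "i < 5" "j < 5"
  shows "card (part {..<n} (\<lambda>v. v mod 5) i) \<le> Suc (card (part {..<n} (\<lambda>v. v mod 5) j))"
proof -
  have "part {..<n} (\<lambda>v. v mod 5) k \<in> residue_parts n" if "k < 5" for k
    using that unfolding residue_parts_def part_def by auto
  moreover have "\<lfloor>real n / 5\<rfloor> \<le> int (card A) \<and> int (card A) \<le> \<lceil>real n / 5\<rceil>"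
    if "A \<in> residue_parts n" for A
    using residue_parts_balanced[OF that] floor_le_ceiling[of "real n / 5"] by fastforce
  moreover have "\<lceil>real n / 5\<rceil> - \<lfloor>real n / 5\<rfloor> \<le> 1" by (rule ceiling_diff_floor_le_1)
  ultimately have "int (card (part {..<n} (\<lambda>v. v mod 5) i)) \<le> int (Suc (card (part {..<n} (\<lambda>v. v mod 5) j)))"
    using assms by (smt (verit) of_nat_Suc)
  then show ?thesis by (simp only: of_nat_le_iff)
qed

lemma isomorphic_symmetric:
  assumes "isomorphic G H" "three_graph G"
  shows "isomorphic H G"
proof -
  obtain f where f: "bij_betw f (verts G) (verts H)" "edges H = (\<lambda>e. f ` e) ` edges G"
    using assms(1) unfolding isomorphic_def by blast
  let ?g = "inv_into (verts G) f"
  have "?g ` f ` e = e" if "e \<in> edges G" for e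
    using that assms(2) f(1) unfolding three_graph_def bij_betw_def
    by (intro inv_into_image_cancel) auto
  then have "(\<lambda>e. ?g ` e) ` edges H = edges G" unfolding f(2) by (force simp: image_image)
  then show ?thesis unfolding isomorphic_def using bij_betw_inv_into[OF f(1)] by metis
qed

lemma isomorphic_card_edges:
  assumes "isomorphic G H" "three_graph G"
  shows "card (edges G) = card (edges H)"
proof -
  obtain f where f: "bij_betw f (verts G) (verts H)" "edges H = (\<lambda>e. f ` e) ` edges G"
    using assms(1) unfolding isomorphic_def by blast
  have "inj_on f (\<Union> (edges G))"
  proof (rule inj_on_subset)
    show "inj_on f (verts G)" using f(1) by (rule bij_betw_imp_inj_on)
    show "\<Union> (edges G) \<subseteq> verts G" using assms(2) unfolding three_graph_def by blast
  qed
  then have "inj_on (\<lambda>e. f ` e) (edges G)" by (rule inj_on_image)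
  then show ?thesis unfolding f(2) by (simp add: card_image)
qed

text \<open>Five balanced numbers with sum \<open>N\<close> take the value
  \<open>N div 5 + 1\<close> exactly \<open>N mod 5\<close> times and \<open>N div 5\<close>
  otherwise, so they are determined up to order.\<close>

lemma balanced_sizes_permute:
  fixes s t :: "nat \<Rightarrow> nat"
  assumes sum: "sum s {..<5} = sum t {..<5}"
    and s: "\<And>i j. i < 5 \<Longrightarrow> j < 5 \<Longrightarrow> s i \<le> Suc (s j)"
    and t: "\<And>i j. i < 5 \<Longrightarrow> j < 5 \<Longrightarrow> t i \<le> Suc (t j)"
  shows "\<exists>\<pi>. bij_betw \<pi> {..<5} {..<5} \<and> (\<forall>i<5. s i = t (\<pi> i))"
proof -
  define N where "N = sum s {..<5}"
  define q where "q = N div 5"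
  have key: "(u i = q \<or> u i = Suc q) \<and> card {i \<in> {..<5}. u i = Suc q} = N mod 5"
    if N: "sum u {..<5} = N" and bal: "\<And>i j. i < 5 \<Longrightarrow> j < 5 \<Longrightarrow> u i \<le> Suc (u j)" and i: "i < 5"
    for u :: "nat \<Rightarrow> nat" and i
  proof -
    define m where "m = Min (u ` {..<5})"
    have "u ` {..<5} \<noteq> {}" using i by auto
    then have "m \<in> u ` {..<5}" unfolding m_def by (intro Min_in) auto
    then obtain k where k: "k < 5" "u k = m" by auto
    have ge: "m \<le> u j" if "j < 5" for j unfolding m_def using that by (intro Min_le) auto
    have val: "u j = m + (if u j = Suc m then 1 else 0)" if "j < 5" for j
      using ge[OF that] bal[OF that k(1)] k(2) by auto
    have sub: "{j \<in> {..<5}. u j = Suc m} \<subseteq> {..<5} - {k}" using k by auto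
    have lt: "card {j \<in> {..<5}. u j = Suc m} < 5"
      using card_mono[OF _ sub] k(1) by simp
    have "N = (\<Sum>j<5. m + (if u j = Suc m then 1 else 0))"
      unfolding N[symmetric] by (rule sum.cong) (use val in auto)
    also have "\<dots> = 5 * m + card {j \<in> {..<5}. u j = Suc m}"
      by (simp add: sum.distrib sum.If_cases Int_def)
    finally have "N = 5 * m + card {j \<in> {..<5}. u j = Suc m}" .
    then have "m = q" "card {j \<in> {..<5}. u j = Suc m} = N mod 5" unfolding q_def using lt by auto
    then show ?thesis using val[OF i] by (auto split: if_splits)
  qed
  have ks: "s i = q \<or> s i = Suc q" "card {i \<in> {..<5}. s i = Suc q} = N mod 5" if "i < 5" for i
    using key[of s i] s that unfolding N_def by auto
  have kt: "t i = q \<or> t i = Suc q" "card {i \<in> {..<5}. t i = Suc q} = N mod 5" if "i < 5" for i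
    using key[of t i] t that sum unfolding N_def by auto
  let ?S = "{i \<in> {..<5}. s i = Suc q}" and ?T = "{i \<in> {..<5}. t i = Suc q}"
  have c: "card ?S = card ?T" using ks(2)[of 0] kt(2)[of 0] by simp
  then obtain \<alpha> where \<alpha>: "bij_betw \<alpha> ?S ?T" using finite_same_card_bij[of ?S ?T] by auto
  have "card ({..<5} - ?S) = card ({..<5} - ?T)" using c by (subst (1 2) card_Diff_subset) auto
  then obtain \<beta> where \<beta>: "bij_betw \<beta> ({..<5} - ?S) ({..<5} - ?T)"
    using finite_same_card_bij[of "{..<5} - ?S" "{..<5} - ?T"] by auto
  define \<pi> where "\<pi> i = (if i \<in> ?S then \<alpha> i else \<beta> i)" for i
  have a': "bij_betw \<pi> ?S ?T" by (rule bij_betw_cong[THEN iffD1, OF _ \<alpha>]) (simp add: \<pi>_def)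
  have b': "bij_betw \<pi> ({..<5} - ?S) ({..<5} - ?T)"
    by (rule bij_betw_cong[THEN iffD1, OF _ \<beta>]) (auto simp: \<pi>_def)
  have un: "?S \<union> ({..<5} - ?S) = {..<5}" "?T \<union> ({..<5} - ?T) = {..<5}" by auto
  have "bij_betw \<pi> {..<5} {..<5}"
    using bij_betw_combine[OF a' b'] unfolding un by auto
  moreover have "s i = t (\<pi> i)" if "i < 5" for i
  proof (cases "i \<in> ?S")
    case True
    then have "\<pi> i \<in> ?T" using a' unfolding bij_betw_def by blast
    then show ?thesis using True by simp
  next
    case False
    then have "\<pi> i \<in> {..<5} - ?T" using b' that unfolding bij_betw_def by blast
    then show ?thesis using kt(1)[of "\<pi> i"] ks(1)[OF that] False that by auto
  qed
  ultimately show ?thesis by blast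
qed

text \<open>\<pi> matches parts with residue classes of equal size, and bijections between matched
  parts are glued along the colouring.\<close>

lemma isomorphic_turan_graph:
  fixes V :: "'a set"
  assumes fin: "finite V" and col: "h ` V \<subseteq> {..<5}"
    and bal: "\<And>i j. i < 5 \<Longrightarrow> j < 5 \<Longrightarrow> card (part V h i) \<le> Suc (card (part V h j))"
    and G: "verts G = V" "edges G = full V h"
  shows "isomorphic G (turan_graph (card V))"
proof -
  let ?n = "card V" and ?c = "\<lambda>v. v mod (5::nat)"
  let ?Q = "part {..<?n} ?c"
  have "real (\<Sum>i<5. card (part V h i)) = real (\<Sum>i<5. card (?Q i))"
    using sum_card_parts[OF fin col] sum_card_parts[OF _ mod5_col, of ?n] by simp
  then have "(\<Sum>i<5. card (part V h i)) = (\<Sum>i<5. card (?Q i))" by linarith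
  then obtain \<pi> where \<pi>: "bij_betw \<pi> {..<5} {..<5}" "\<And>i. i < 5 \<Longrightarrow> card (part V h i) = card (?Q (\<pi> i))"
    using balanced_sizes_permute[of "\<lambda>i. card (part V h i)" "\<lambda>i. card (?Q i)"]
      bal residue_part_balanced by blast
  have "\<exists>g. bij_betw g (part V h i) (?Q (\<pi> i))" if "i < 5" for i
    using \<pi>(2)[OF that] fin by (intro finite_same_card_bij) (auto simp: part_def)
  then obtain g where g: "\<And>i. i < 5 \<Longrightarrow> bij_betw (g i) (part V h i) (?Q (\<pi> i))" by metis
  define \<phi> where "\<phi> x = g (h x) x" for x
  have h5: "h x < 5" if "x \<in> V" for x using that col by auto
  have \<phi>Q: "\<phi> x \<in> ?Q (\<pi> (h x))" if "x \<in> V" for x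
    using g[OF h5[OF that]] that unfolding \<phi>_def bij_betw_def part_def by auto
  have col_iff: "?c (\<phi> x) = ?c (\<phi> y) \<longleftrightarrow> h x = h y" if "x \<in> V" "y \<in> V" for x y
    using \<phi>Q[OF that(1)] \<phi>Q[OF that(2)] \<pi>(1) h5[OF that(1)] h5[OF that(2)]
    unfolding part_def bij_betw_def inj_on_def by auto
  have inj: "inj_on \<phi> V"
  proof (rule inj_onI)
    fix x y assume xy: "x \<in> V" "y \<in> V" "\<phi> x = \<phi> y"
    then have "h x = h y" using col_iff by metis
    then show "x = y" using g[OF h5[OF xy(1)]] xy unfolding \<phi>_def bij_betw_def inj_on_def part_def by auto
  qed
  have "\<phi> ` V \<subseteq> {..<?n}" using \<phi>Q unfolding part_def by auto
  then have im: "\<phi> ` V = {..<?n}"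
    by (rule card_subset_eq[rotated]) (simp_all add: card_image[OF inj])
  have "full {..<?n} ?c = (\<lambda>e. \<phi> ` e) ` full V h"
  proof (intro equalityI subsetI)
    fix e assume e: "e \<in> full {..<?n} ?c"
    then have "e \<subseteq> \<phi> ` V" using im unfolding full_def by auto
    then obtain d where d: "d \<subseteq> V" "e = \<phi> ` d" by (meson subset_image_iff)
    have "card d = 3" using e d card_image[OF inj_on_subset[OF inj d(1)]] unfolding full_def by auto
    moreover have "inj_on h d"
      using e inj_on_subset[OF inj d(1)] col_iff d(1) unfolding full_def d(2) inj_on_def by blast
    ultimately show "e \<in> (\<lambda>e. \<phi> ` e) ` full V h" using d unfolding full_def by blast
  next
    fix e assume "e \<in> (\<lambda>e. \<phi> ` e) ` full V h"
    then obtain d where d: "d \<subseteq> V" "card d = 3" "inj_on h d" "e = \<phi> ` d" unfolding full_def by auto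
    have "card e = 3" using d card_image[OF inj_on_subset[OF inj d(1)]] by simp
    moreover have "inj_on ?c e"
      using d(3) col_iff d(1) unfolding d(4) inj_on_def by blast
    ultimately show "e \<in> full {..<?n} ?c" using d im unfolding full_def by auto
  qed
  then show ?thesis
    unfolding isomorphic_def G turan_graph_verts turan_graph_edges
    using inj im unfolding bij_betw_def by blast
qed

section \<open>Optimality of balanced colourings\<close>

lemma part_recolour:
  assumes "x \<in> part V h i" "i \<noteq> j"
  shows "part V (h(x := j)) k =
    (if k = i then part V h i - {x} else if k = j then insert x (part V h j) else part V h k)"
  using assms by (auto simp: part_def)

text \<open>Moving a vertex from part \<open>i\<close> to part \<open>j\<close> changes the number
  of edges by \<open>(s i - s j - 1) * (n - s i - s j)\<close>. At a maximum with a gap of at least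
  2 the second factor vanishes; then only two colours occur and there is no edge at all.\<close>

lemma maximal_full_balanced:
  assumes fin: "finite V" and col: "h ` V \<subseteq> {..<5}" and ne: "full V h \<noteq> {}"
    and max: "\<And>h'. h' ` V \<subseteq> {..<5} \<Longrightarrow> card (full V h') \<le> card (full V h)"
    and ij: "i < 5" "j < 5"
  shows "card (part V h i) \<le> Suc (card (part V h j))"
proof (rule ccontr)
  assume gap: "\<not> ?thesis"
  then have neq: "i \<noteq> j" by auto
  have finP: "finite (part V h k)" for k using fin by (auto simp: part_def)
  have "part V h i \<noteq> {}" using gap by auto
  then obtain x where x: "x \<in> part V h i" by auto
  define h' where "h' = h(x := j)"
  have col': "h' ` V \<subseteq> {..<5}" using col ij unfolding h'_def by auto
  define n where "n = real (card V)"
  define s where "s k = real (card (part V h k))" for k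
  define s' where "s' k = real (card (part V h' k))" for k
  have x_notin: "x \<notin> part V h j" using x neq by (auto simp: part_def)
  have "card (part V h i) \<ge> 1" using gap by simp
  then have si: "s' i = s i - 1" "s' j = s j + 1"
    using x x_notin neq finP unfolding s'_def s_def h'_def part_recolour[OF x neq]
    by (auto simp: card_Diff_singleton of_nat_diff)
  have sk: "s' k = s k" if "k \<noteq> i" "k \<noteq> j" for k
    using that unfolding s'_def s_def h'_def part_recolour[OF x neq] by simp
  have split: "(\<Sum>k<5. u k) = u i + u j + (\<Sum>k\<in>{..<5} - {i, j}. u k)" for u :: "nat \<Rightarrow> real"
  proof -
    have "(\<Sum>k<5. u k) = (\<Sum>k\<in>{i, j}. u k) + (\<Sum>k\<in>{..<5} - {i, j}. u k)"
      by (subst sum.subset_diff[of "{i, j}"]) (use ij in auto)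
    then show ?thesis using neq by simp
  qed
  have rest: "(\<Sum>k\<in>{..<5} - {i, j}. u (s' k)) = (\<Sum>k\<in>{..<5} - {i, j}. u (s k))" for u :: "real \<Rightarrow> real"
    by (rule sum.cong) (use sk in auto)
  have f: "6 * real (card (full V h)) = n ^ 3 - 3 * n * (\<Sum>k<5. (s k)\<^sup>2) + 2 * (\<Sum>k<5. s k ^ 3)"
    unfolding n_def s_def by (rule card_full[OF fin col])
  have f': "6 * real (card (full V h')) = n ^ 3 - 3 * n * (\<Sum>k<5. (s' k)\<^sup>2) + 2 * (\<Sum>k<5. s' k ^ 3)"
    unfolding n_def s'_def by (rule card_full[OF fin col'])
  have "6 * real (card (full V h')) - 6 * real (card (full V h)) = 6 * (s i - s j - 1) * (n - s i - s j)"
    unfolding f f' split rest[of "\<lambda>x. x\<^sup>2"] rest[of "\<lambda>x. x ^ 3"] si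
    by (simp add: power2_eq_square power3_eq_cube algebra_simps)
  moreover have "real (card (full V h')) \<le> real (card (full V h))" using max[OF col'] by simp
  moreover have "s i - s j - 1 > 0" using gap unfolding s_def by linarith
  ultimately have "n - s i - s j \<le> 0" by (smt (verit) mult_pos_pos)
  moreover have "n = s i + s j + (\<Sum>k\<in>{..<5} - {i, j}. s k)"
    using sum_card_parts[OF fin col] split[of s] unfolding n_def s_def by linarith
  ultimately have "(\<Sum>k\<in>{..<5} - {i, j}. s k) \<le> 0" by linarith
  moreover have nn: "s k \<ge> 0" for k unfolding s_def by simp
  ultimately have "(\<Sum>k\<in>{..<5} - {i, j}. s k) = 0" using sum_nonneg[of "{..<5} - {i, j}" s] by force
  then have zero: "s k = 0" if "k \<in> {..<5} - {i, j}" for k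
    using that nn by (subst (asm) sum_nonneg_eq_0_iff) auto
  have hV: "h ` V \<subseteq> {i, j}"
  proof (rule image_subsetI, rule ccontr)
    fix y assume y: "y \<in> V" "h y \<notin> {i, j}"
    then have "s (h y) = 0" using col by (intro zero) auto
    then show False using y finP unfolding s_def part_def by auto
  qed
  obtain e where e: "e \<in> full V h" using ne by blast
  then have "card (h ` e) = 3" "h ` e \<subseteq> {i, j}" using hV unfolding full_def by (auto simp: card_image)
  then have "3 \<le> card {i, j}" by (metis card_mono finite.emptyI finite.insertI)
  then show False by (simp add: card_insert_if split: if_splits)
qed

text \<open>A colouring \<open>h0\<close> with most edges is balanced, hence gives the Turan graph,
  and this identifies the maximum. Three vertices ensure that the maximum is positive, as the
  balancing argument requires.\<close>

lemma full_le_turan_size: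
  fixes V :: "'a set"
  assumes fin: "finite V" and n: "card V \<ge> 3" and col: "h ` V \<subseteq> {..<5}"
  shows "card (full V h) \<le> turan_size (card V)"
    and "\<lbrakk>card (full V h) = turan_size (card V); verts G = V; edges G = full V h\<rbrakk>
      \<Longrightarrow> isomorphic G (turan_graph (card V))"
proof -
  have fullfin: "finite (full V h)" for h by (rule uniform3_finite_edges[OF uniform3_full[OF fin]])
  have bound: "card (full V h) \<le> card (Pow V)" for h
    by (rule card_mono) (use fin in \<open>auto simp: full_def\<close>)
  obtain h0 where h0: "h0 ` V \<subseteq> {..<5::nat}"
    and max: "\<And>h'. h' ` V \<subseteq> {..<5} \<Longrightarrow> card (full V h') \<le> card (full V h0)"
    using ex_has_greatest_nat[of "\<lambda>h. h ` V \<subseteq> {..<5::nat}" h "\<lambda>h. card (full V h)" "Suc (card (Pow V))"] col bound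
    by (auto simp: less_Suc_eq_le simp del: card_Pow)
  obtain T where "T \<subseteq> V" "card T = 3" using obtain_subset_with_card_n[OF n] by metis
  then obtain a b c where abc: "a \<noteq> b" "a \<noteq> c" "b \<noteq> c" "a \<in> V" "b \<in> V" "c \<in> V"
    unfolding card_3_iff by auto
  define h1 where "h1 x = (if x = a then 0 else if x = b then 1 else 2 :: nat)" for x
  have "{a, b, c} \<in> full V h1" unfolding triple_in_full_iff h1_def using abc by auto
  then have pos: "0 < card (full V h1)" using fullfin by (auto simp: card_gt_0_iff)
  have "h1 ` V \<subseteq> {..<5}" unfolding h1_def by auto
  from max[OF this] have pos0: "0 < card (full V h0)" using pos by linarith
  have iso: "isomorphic G (turan_graph (card V))"
    if g: "g ` V \<subseteq> {..<5}" and eq: "card (full V g) = card (full V h0)"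
      and G: "verts G = V" "edges G = full V g" for g and G :: "'a hypergraph"
  proof (rule isomorphic_turan_graph[OF fin g _ G])
    fix i j :: nat assume "i < 5" "j < 5"
    then show "card (part V g i) \<le> Suc (card (part V g j))"
      using max eq pos0 by (intro maximal_full_balanced[OF fin g]) auto
  qed
  have size: "card (full V h0) = turan_size (card V)"
    using isomorphic_card_edges[OF iso[OF h0 refl, of "\<lparr>verts = V, edges = full V h0\<rparr>"]]
      uniform3_full[OF fin, of h0] by (simp add: three_graph_iff turan_size_def)
  show "card (full V h) \<le> turan_size (card V)" using max[OF col] size by simp
  show "isomorphic G (turan_graph (card V))"
    if "card (full V h) = turan_size (card V)" "verts G = V" "edges G = full V h"
    using iso[OF col _ that(2,3)] that(1) size by simp
qed

section \<open>Increments of \<open>turan_size\<close>\<close>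

lemma turan_size_Suc:
  "turan_size (Suc m) = turan_size m + degree (full {..<Suc m} (\<lambda>v. v mod 5)) m"
proof -
  let ?F = "full {..<Suc m} (\<lambda>v. v mod 5)"
  have fin: "finite ?F" by (rule uniform3_finite_edges[OF uniform3_full]) simp
  have "?F = full {..<m} (\<lambda>v. v mod 5) \<union> {e \<in> ?F. m \<in> e}"
    unfolding full_def by (auto simp: lessThan_Suc)
  moreover have "full {..<m} (\<lambda>v. v mod 5) \<inter> {e \<in> ?F. m \<in> e} = {}" unfolding full_def by auto
  moreover have "finite (full {..<m} (\<lambda>v. v mod 5))"
    by (rule uniform3_finite_edges[OF uniform3_full]) simp
  ultimately have "card ?F = card (full {..<m} (\<lambda>v. v mod 5)) + card {e \<in> ?F. m \<in> e}"
    using card_Un_disjoint[of "full {..<m} (\<lambda>v. v mod 5)" "{e \<in> ?F. m \<in> e}"] fin by simp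
  then show ?thesis unfolding turan_size_def turan_graph_edges degree_def .
qed

text \<open>All parts differ from \<open>n / 5\<close> by at most 1, so the formula for degrees
  gives \<open>12 / 25 * n\<^sup>2\<close> up to a linear error.\<close>

lemma turan_size_diff_ge:
  assumes n: "n = real (Suc m)"
  shows "12 / 25 * n\<^sup>2 - 2 * n - 5 \<le> 2 * real (degree (full {..<Suc m} (\<lambda>v. v mod 5)) m)"
proof -
  let ?P = "part {..<Suc m} (\<lambda>v. v mod 5)"
  define d where "d i = real (card (?P i)) - n / 5" for i
  have s: "real (card (?P i)) = d i + n / 5" for i unfolding d_def by simp
  have tot: "(\<Sum>i<5. real (card (?P i))) = n"
    using sum_card_parts[OF finite_lessThan mod5_col, of "Suc m"] n by simp
  then have d0: "(\<Sum>i<5. d i) = 0" unfolding d_def by (simp add: sum_subtractf)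
  have d1: "\<bar>d i\<bar> \<le> 1" if i: "i < 5" for i
  proof -
    have "5 * real (card (?P i)) = (\<Sum>j<(5::nat). real (card (?P i)))" by simp
    also have "\<dots> \<le> (\<Sum>j<5. real (card (?P j)) + 1)"
      by (rule sum_mono) (use residue_part_balanced[OF i, of _ "Suc m"] in force)
    also have "\<dots> = n + 5" using tot by (simp add: sum.distrib)
    finally have "d i \<le> 1" unfolding d_def by simp
    moreover have "(\<Sum>j<5. real (card (?P j))) \<le> (\<Sum>j<(5::nat). real (card (?P i)) + 1)"
      by (rule sum_mono) (use residue_part_balanced[OF _ i, of _ "Suc m"] in force)
    then have "-1 \<le> d i" using tot unfolding d_def by simp
    ultimately show ?thesis by simp
  qed
  have "(\<Sum>i<5. (real (card (?P i)))\<^sup>2) = (\<Sum>i<5. (d i)\<^sup>2 + 2 * n / 5 * d i + n\<^sup>2 / 25)"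
    unfolding s by (intro sum.cong) (simp_all add: power2_eq_square field_simps)
  also have "\<dots> = (\<Sum>i<5. (d i)\<^sup>2) + 2 * n / 5 * (\<Sum>i<5. d i) + n\<^sup>2 / 5"
    by (simp only: sum.distrib sum_distrib_left[symmetric]) simp
  also have "(\<Sum>i<5. (d i)\<^sup>2) \<le> (\<Sum>i<(5::nat). 1)"
    by (rule sum_mono) (use d1 in \<open>auto simp: abs_square_le_1\<close>)
  finally have p2: "(\<Sum>i<5. (real (card (?P i)))\<^sup>2) \<le> n\<^sup>2 / 5 + 5" using d0 by simp
  let ?i = "m mod 5"
  have "2 * real (degree (full {..<Suc m} (\<lambda>v. v mod 5)) m) =
      (n - (d ?i + n / 5))\<^sup>2 + (d ?i + n / 5)\<^sup>2 - (\<Sum>i<5. (real (card (?P i)))\<^sup>2)"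
    using degree_full[OF finite_lessThan mod5_col, of m "Suc m"] n unfolding s[symmetric] by simp
  moreover have "(n - (d ?i + n / 5))\<^sup>2 + (d ?i + n / 5)\<^sup>2 = 17 / 25 * n\<^sup>2 + 2 * (d ?i)\<^sup>2 - 6 / 5 * (n * d ?i)"
    by (simp add: power2_eq_square field_simps)
  moreover have "n * d ?i \<le> n * 1" using d1[of ?i] n by (intro mult_left_mono) auto
  moreover have "0 \<le> (d ?i)\<^sup>2" by simp
  ultimately show ?thesis using p2 n by linarith
qed

section \<open>Copies of \<open>K33\<close> against codegrees and 5-colourings\<close>

lemma distinct_representatives:
  assumes "finite I" "finite A"
    and "\<And>p. p \<in> I \<Longrightarrow> finite (S p) \<and> card I + card A \<le> card (S p)"
  shows "\<exists>z. inj_on z I \<and> (\<forall>p\<in>I. z p \<in> S p - A)"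
  using assms
proof (induction I rule: finite_induct)
  case empty
  then show ?case by simp
next
  case (insert q I)
  then obtain z where z: "inj_on z I" "\<forall>p\<in>I. z p \<in> S p - A" by fastforce
  have "card (z ` I \<union> A) \<le> card I + card A"
    using card_Un_le[of "z ` I" A] card_image_le[of I z] insert.hyps by linarith
  also have "\<dots> < card (S q)" using insert.hyps insert.prems(2)[of q] by simp
  finally have "\<not> S q \<subseteq> z ` I \<union> A"
    using card_mono[of "z ` I \<union> A" "S q"] insert.hyps insert.prems by fastforce
  then obtain w where w: "w \<in> S q" "w \<notin> z ` I" "w \<notin> A" by blast
  have "inj_on (z(q := w)) (insert q I)"
    using z(1) w(2) insert.hyps by (auto simp: inj_on_def)
  moreover have "\<forall>p\<in>insert q I. (z(q := w)) p \<in> S p - A"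
    using z(2) w insert.hyps by auto
  ultimately show ?case by blast
qed

text \<open>If all cross pairs of two edges have codegree at least 15, the edges are disjoint and
  the vertices \<open>Vz i j\<close> can be chosen one by one: at most 8 earlier choices and 6 core
  vertices are forbidden.\<close>

lemma K33_free_cross_sparse:
  fixes G :: "'a hypergraph"
  assumes G: "three_graph G" and free: "is_free K33 G"
  shows "cross_sparse 15 (edges G)"
proof (rule ccontr)
  let ?E = "edges G" and ?I = "{1..3::nat}"
  have unif: "uniform3 (verts G) ?E" using G unfolding three_graph_iff .
  assume "\<not> ?thesis"
  then obtain X Y where X: "X \<in> ?E" and Y: "Y \<in> ?E"
    and "\<not> (\<exists>x\<in>X. \<exists>y\<in>Y. codeg ?E x y < 15)" unfolding cross_sparse_def by blast
  then have large: "15 \<le> codeg ?E x y" if "x \<in> X" "y \<in> Y" for x y using that by (meson not_le)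
  obtain a1 a2 a3 where a: "X = {a1, a2, a3}" "a1 \<noteq> a2" "a1 \<noteq> a3" "a2 \<noteq> a3"
    using uniform3_edgeE[OF unif X] .
  obtain b1 b2 b3 where b: "Y = {b1, b2, b3}" "b1 \<noteq> b2" "b1 \<noteq> b3" "b2 \<noteq> b3"
    using uniform3_edgeE[OF unif Y] .
  define x where "x i = (if i = 1 then a1 else if i = 2 then a2 else a3)" for i :: nat
  define y where "y i = (if i = 1 then b1 else if i = 2 then b2 else b3)" for i :: nat
  have x: "inj_on x ?I" "x ` ?I = X" and y: "inj_on y ?I" "y ` ?I = Y"
    using a b unfolding x_def y_def inj_on_def by (auto simp: numeral_3_eq_3 atLeastAtMostSuc_conv)
  have disj: "X \<inter> Y = {}" using large codeg_same[OF unif] by fastforce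
  define S where "S p = {w. {x (fst p), y (snd p), w} \<in> ?E}" for p
  have "card X = 3" "card Y = 3" using a b by auto
  have "\<exists>z. inj_on z (?I \<times> ?I) \<and> (\<forall>p\<in>?I \<times> ?I. z p \<in> S p - (X \<union> Y))"
  proof (rule distinct_representatives)
    fix p assume p: "p \<in> ?I \<times> ?I"
    then have "15 \<le> codeg ?E (x (fst p)) (y (snd p))" using x(2) y(2) by (intro large) auto
    then have "15 \<le> card (S p)" unfolding S_def codeg_def .
    moreover have "card (X \<union> Y) \<le> 6" using card_Un_le[of X Y] \<open>card X = 3\<close> \<open>card Y = 3\<close> by simp
    ultimately show "finite (S p) \<and> card (?I \<times> ?I) + card (X \<union> Y) \<le> card (S p)"
      using finite_conbrs[OF unif] unfolding S_def by (simp add: card_cartesian_product)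
  qed (use a b in auto)
  then obtain z where z: "inj_on z (?I \<times> ?I)" "\<And>p. p \<in> ?I \<times> ?I \<Longrightarrow> z p \<in> S p - (X \<union> Y)" by blast
  define g where "g v = (case v of Vx i \<Rightarrow> x i | Vy j \<Rightarrow> y j | Vz i j \<Rightarrow> z (i, j))" for v
  have xX: "x i \<in> X" and yY: "y i \<in> Y" if "i \<in> ?I" for i using that x(2) y(2) by auto
  have zN: "z (i, j) \<notin> X" "z (i, j) \<notin> Y" "{x i, y j, z (i, j)} \<in> ?E" if "i \<in> ?I" "j \<in> ?I" for i j
    using z(2)[of "(i, j)"] that unfolding S_def by auto
  have inj: "inj_on g (verts K33)"
  proof (rule inj_onI)
    fix v w assume vw: "v \<in> verts K33" "w \<in> verts K33" "g v = g w"
    have xy: "x i \<noteq> y j" if "i \<in> ?I" "j \<in> ?I" for i j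
      using xX[OF that(1)] yY[OF that(2)] disj by auto
    have xz: "x i \<noteq> z (j, k)" "y i \<noteq> z (j, k)" if "i \<in> ?I" "j \<in> ?I" "k \<in> ?I" for i j k
      using xX[OF that(1)] yY[OF that(1)] zN(1,2)[OF that(2,3)] by auto
    have zz: "i = i' \<and> j = j'" if "z (i, j) = z (i', j')" "i \<in> ?I" "j \<in> ?I" "i' \<in> ?I" "j' \<in> ?I" for i j i' j'
      using inj_onD[OF z(1) that(1)] that by simp
    have cases: "(\<exists>i\<in>?I. u = Vx i) \<or> (\<exists>i\<in>?I. u = Vy i) \<or> (\<exists>i\<in>?I. \<exists>j\<in>?I. u = Vz i j)"
      if "u \<in> verts K33" for u
      using that unfolding K33_def by auto
    from cases[OF vw(1)] cases[OF vw(2)] vw(3) show "v = w"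
      using inj_onD[OF x(1)] inj_onD[OF y(1)] zz xy xz xy[symmetric] xz[symmetric]
      unfolding g_def by (elim disjE bexE) (simp_all del: atLeastAtMost_iff)
  qed
  have K: "three_graph K33" by (rule K33_counts(1))
  define H where "H = \<lparr>verts = g ` verts K33, edges = (\<lambda>e. g ` e) ` edges K33\<rparr>"
  have iso: "isomorphic K33 H"
    unfolding isomorphic_def H_def using inj by (auto simp: bij_betw_def)
  have tH: "three_graph H"
    using K inj unfolding three_graph_def H_def
    by (auto simp: card_image[OF inj_on_subset[OF inj]])
  have "edges H \<subseteq> ?E"
  proof
    fix e assume "e \<in> edges H"
    then obtain d where d: "d \<in> edges K33" "e = g ` d" unfolding H_def by auto
    have "X = {x 1, x 2, x 3}" "Y = {y 1, y 2, y 3}" unfolding a b x_def y_def by auto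
    then have "g ` {Vx 1, Vx 2, Vx 3} = X" "g ` {Vy 1, Vy 2, Vy 3} = Y" unfolding g_def by auto
    moreover have "g ` {Vx i, Vy j, Vz i j} \<in> ?E" if "i \<in> ?I" "j \<in> ?I" for i j
      using zN(3)[OF that] unfolding g_def by simp
    ultimately show "e \<in> ?E" using d X Y unfolding K33_def hypergraph.simps by auto
  qed
  moreover have "verts H \<subseteq> verts G"
  proof
    fix v assume "v \<in> verts H"
    then obtain u where u: "u \<in> verts K33" "v = g u" unfolding H_def by auto
    have V: "X \<subseteq> verts G" "Y \<subseteq> verts G" using X Y unif unfolding uniform3_def by auto
    moreover have "z (i, j) \<in> verts G" if "i \<in> ?I" "j \<in> ?I" for i j
      using uniform3_triple(6)[OF unif zN(3)[OF that]] .
    ultimately show "v \<in> verts G" using u xX yY unfolding K33_def g_def hypergraph.simps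
      by (auto simp del: atLeastAtMost_iff)
  qed
  ultimately have "subgraph H G" using tH unfolding subgraph_def by simp
  moreover have "isomorphic H K33" by (rule isomorphic_symmetric[OF iso K])
  ultimately show False using free unfolding is_free_def by blast
qed

text \<open>The six vertices \<open>Vx i\<close>, \<open>Vy j\<close> are pairwise covered by edges
  of \<open>K33\<close>, so a copy would need six colours.\<close>

lemma rainbow_K33_free:
  assumes rb: "rainbow (verts G) h (edges G)"
  shows "is_free K33 G"
  unfolding is_free_def
proof
  let ?I = "{1..3::nat}"
  assume "\<exists>H. subgraph H G \<and> isomorphic H K33"
  then obtain H where H: "subgraph H G" "isomorphic H K33" by blast
  then have "isomorphic K33 H" using isomorphic_symmetric unfolding subgraph_def by blast
  then obtain g where g: "bij_betw g (verts K33) (verts H)" "edges H = (\<lambda>e. g ` e) ` edges K33"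
    unfolding isomorphic_def by blast
  have gV: "g v \<in> verts G" if "v \<in> verts K33" for v
    using that g(1) H(1) unfolding bij_betw_def subgraph_def by auto
  define c where "c v = h (g v)" for v
  have c5: "c v < 5" if "v \<in> verts K33" for v using gV[OF that] rb unfolding c_def rainbow_def by auto
  have KV: "e \<subseteq> verts K33" if "e \<in> edges K33" for e using that K33_counts(1) unfolding three_graph_def by blast
  have inj: "inj_on c e" if e: "e \<in> edges K33" for e
  proof -
    have "inj_on h (g ` e)" using e g(2) H(1) rb unfolding subgraph_def rainbow_def by blast
    moreover have "inj_on g e" using inj_on_subset[OF _ KV[OF e]] g(1) unfolding bij_betw_def by blast
    ultimately show ?thesis unfolding c_def using comp_inj_on[of g e h] by (simp add: comp_def)
  qed
  let ?S = "{Vx 1, Vx 2, Vx 3, Vy 1, Vy 2, Vy 3}"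
  have eX: "{Vx 1, Vx 2, Vx 3} \<in> edges K33" and eY: "{Vy 1, Vy 2, Vy 3} \<in> edges K33"
    and eXY: "\<And>i j. i \<in> ?I \<Longrightarrow> j \<in> ?I \<Longrightarrow> {Vx i, Vy j, Vz i j} \<in> edges K33"
    unfolding K33_def hypergraph.simps by blast+
  have xy: "c (Vx i) \<noteq> c (Vy j)" if "i \<in> ?I" "j \<in> ?I" for i j
    using inj[OF eXY[OF that]] by (auto simp: inj_on_def)
  have "inj_on c ?S"
    using inj[OF eX] inj[OF eY] xy[of 1 1] xy[of 1 2] xy[of 1 3] xy[of 2 1] xy[of 2 2] xy[of 2 3]
      xy[of 3 1] xy[of 3 2] xy[of 3 3]
    by (simp del: One_nat_def)
  moreover have "c ` ?S \<subseteq> {..<5}" using KV[OF eX] KV[OF eY] c5 by auto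
  ultimately have "card ?S \<le> card {..<5::nat}" using card_inj_on_le[of c ?S "{..<5}"] by blast
  then show False by (simp add: card_insert_if)
qed

section \<open>Passing to large minimum degree\<close>

lemma uniform3_delete: "uniform3 V E \<Longrightarrow> uniform3 (V - {v}) {e \<in> E. v \<notin> e}"
  by (auto simp: uniform3_def)

lemma card_delete: "finite E \<Longrightarrow> card E = card {e \<in> E. v \<notin> e} + degree E v"
proof -
  assume fin: "finite E"
  have "E = {e \<in> E. v \<notin> e} \<union> {e \<in> E. v \<in> e}" by blast
  then have "card E = card ({e \<in> E. v \<notin> e} \<union> {e \<in> E. v \<in> e})" by (rule arg_cong)
  also have "\<dots> = card {e \<in> E. v \<notin> e} + card {e \<in> E. v \<in> e}"
    by (rule card_Un_disjoint) (use fin in auto)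
  finally show ?thesis unfolding degree_def .
qed

text \<open>Degrees at least the increment of \<open>turan_size\<close> serve twice: each is large
  enough by itself, and their sum gives the required number of edges.\<close>

lemma rainbow_of_turan_degrees:
  assumes E: "uniform3 V E" "cross_sparse 15 E" and large: "card V = Suc m" "m \<ge> 10 ^ 16"
    and deg: "\<And>v. v \<in> V \<Longrightarrow> turan_size (Suc m) \<le> turan_size m + degree E v"
  shows "\<exists>h. rainbow V h E"
proof (rule rainbow_of_large_degrees[OF E])
  define n where "n = real (Suc m)"
  have nV: "real (card V) = n" using large(1) unfolding n_def by simp
  have "real (10 ^ 16) \<le> real m" by (rule of_nat_mono[OF large(2)])
  then have n: "n \<ge> 10 ^ 16" "n > 0" unfolding n_def by simp_all
  have n5: "n \<ge> 5" using n(1) by simp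
  show "10 ^ 16 \<le> real (card V)" unfolding nV by (rule n(1))
  have n2: "10 ^ 16 * n \<le> n\<^sup>2" using mult_right_mono[OF n(1), of n] n(2) by (simp add: power2_eq_square)
  have low: "12 / 25 * n\<^sup>2 - 3 * n \<le> 2 * real (degree E v)" if "v \<in> V" for v
  proof -
    have "degree (full {..<Suc m} (\<lambda>v. v mod 5)) m \<le> degree E v"
      using deg[OF that] unfolding turan_size_Suc by simp
    then have "real (degree (full {..<Suc m} (\<lambda>v. v mod 5)) m) \<le> real (degree E v)" by simp
    then show ?thesis using turan_size_diff_ge[OF n_def] n5 by linarith
  qed
  show "(12 / 25 - 1 / 1000) * (real (card V))\<^sup>2 \<le> 2 * real (degree E v)" if "v \<in> V" for v
    using low[OF that] n2 n(2) unfolding nV by (simp add: algebra_simps)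
  have "(\<Sum>v\<in>V. 12 / 25 * n\<^sup>2 - 3 * n) \<le> (\<Sum>v\<in>V. 2 * real (degree E v))"
    by (rule sum_mono) (rule low)
  also have "\<dots> = 6 * real (card E)"
    using arg_cong[OF sum_degree[OF E(1)], of real] by (simp add: sum_distrib_left[symmetric])
  finally have "n * (12 / 25 * n\<^sup>2 - 3 * n) \<le> 6 * real (card E)" by (simp add: nV)
  moreover have "n * (12 / 25 * n\<^sup>2 - 3 * n) = 12 / 25 * n ^ 3 - 3 * n\<^sup>2"
    by (simp add: power2_eq_square power3_eq_cube algebra_simps)
  moreover have "10 ^ 16 * n\<^sup>2 \<le> n ^ 3"
    using mult_right_mono[OF n(1), of "n\<^sup>2"] by (simp add: power2_eq_square power3_eq_cube)
  moreover have "(2 / 25 - 1 / (2 * 10 ^ 13)) * c \<le> a"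
    if "12 / 25 * c - 3 * s \<le> 6 * a" "10 ^ 16 * s \<le> c" "s \<ge> 0" for a c s :: real
    using that by simp
  ultimately show "(2 / 25 - 1 / (2 * 10 ^ 13)) * real (card V) ^ 3 \<le> real (card E)"
    unfolding nV by (metis zero_le_power2)
qed

lemma rainbow_card_le_turan_size:
  assumes "uniform3 V E" "rainbow V h E" "card V \<ge> 3"
  shows "card E \<le> turan_size (card V)"
proof -
  have fin: "finite V" using assms(1) by (rule uniform3_finite)
  have "card E \<le> card (full V h)"
    by (rule card_mono[OF uniform3_finite_edges[OF uniform3_full[OF fin]] rainbow_subset_full[OF assms(1,2)]])
  then show ?thesis using full_le_turan_size(1)[OF fin assms(3)] assms(2) unfolding rainbow_def by force
qed

text \<open>Deleting vertices of degree smaller than in the Turan graph gains an edge at each step, which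
  cannot go on down to a bounded number of vertices.\<close>

lemma excess_bound:
  assumes "uniform3 V E" "cross_sparse 15 E" "card V = N + k" "card E > turan_size (card V)"
    and N: "N \<ge> 10 ^ 16"
  shows "card E + k \<le> turan_size (card V) + 2 ^ N"
  using assms(1-4)
proof (induction k arbitrary: V E)
  case 0
  have "card E \<le> card (Pow V)"
    by (rule card_mono) (use 0(1) in \<open>auto simp: uniform3_def\<close>)
  also have "\<dots> = 2 ^ N" using 0(1,3) by (simp add: card_Pow uniform3_finite)
  finally show ?case by linarith
next
  case (Suc k)
  define m where "m = N + k"
  have m: "card V = Suc m" "m \<ge> 10 ^ 16" using Suc.prems(3) N unfolding m_def by linarith+
  have finE: "finite E" by (rule uniform3_finite_edges[OF Suc.prems(1)])
  have "\<not> (\<exists>h. rainbow V h E)"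
  proof
    assume "\<exists>h. rainbow V h E"
    moreover have "(3::nat) \<le> 10 ^ 16" by simp
    then have "card V \<ge> 3" using m by linarith
    ultimately show False
      using rainbow_card_le_turan_size[OF Suc.prems(1)] Suc.prems(4) by (meson not_le)
  qed
  \<comment> \<open>Too many edges exclude a 5-colouring, so the degree condition fails at some
    \<open>v\<close>; deleting it raises the excess over \<open>turan_size\<close> by at least
    1.\<close>
  then obtain v where v: "v \<in> V" "turan_size m + degree E v < turan_size (Suc m)"
    using rainbow_of_turan_degrees[OF Suc.prems(1,2) m] by (meson not_le)
  let ?E = "{e \<in> E. v \<notin> e}"
  have c: "card E = card ?E + degree E v" by (rule card_delete[OF finE])
  have cV: "card (V - {v}) = m" using m(1) v(1) by simp
  have "card ?E + k \<le> turan_size (card (V - {v})) + 2 ^ N"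
  proof (rule Suc.IH[OF uniform3_delete[OF Suc.prems(1)]])
    show "cross_sparse 15 ?E" by (rule cross_sparse_subset[OF Suc.prems(1,2)]) auto
    show "card (V - {v}) = N + k" unfolding cV m_def ..
    show "turan_size (card (V - {v})) < card ?E"
      using Suc.prems(4) v(2) c unfolding cV m(1) by linarith
  qed
  then show ?case using v(2) c unfolding cV m(1) by linarith
qed

text \<open>The extra 1 in the threshold makes the bound available after deleting one vertex. In the
  case of equality it shows that every degree reaches the Turan increment, so \<open>G\<close> is
  5-colourable and, by its number of edges, complete for its colouring.\<close>

theorem turan_K33:
  fixes G :: "'a hypergraph"
  assumes G: "three_graph G" "is_free K33 G" and n: "card (verts G) = n" "n \<ge> N + 2 ^ N + 1"
    and N: "N \<ge> 10 ^ 16"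
  shows "card (edges G) \<le> turan_size n"
    and "card (edges G) = turan_size n \<Longrightarrow> isomorphic G (turan_graph n)"
proof -
  let ?V = "verts G" and ?E = "edges G"
  have unif: "uniform3 ?V ?E" using G(1) unfolding three_graph_iff .
  have sparse: "cross_sparse 15 ?E" by (rule K33_free_cross_sparse[OF G])
  have bound: "card E \<le> turan_size (card V)"
    if "uniform3 V E" "cross_sparse 15 E" "card V \<ge> N + 2 ^ N" for V :: "'a set" and E
  proof (rule ccontr)
    assume gt: "\<not> ?thesis"
    define k where "k = card V - N"
    have "card V = N + k" "k \<ge> 2 ^ N" using that(3) unfolding k_def by linarith+
    with excess_bound[OF that(1,2) _ _ N, of k] gt show False by linarith
  qed
  show le: "card ?E \<le> turan_size n" using bound[OF unif sparse] n by simp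
  assume eq: "card ?E = turan_size n"
  define m where "m = n - 1"
  have m: "card ?V = Suc m" "m \<ge> N + 2 ^ N" using n unfolding m_def by linarith+
  have "turan_size (Suc m) \<le> turan_size m + degree ?E v" if v: "v \<in> ?V" for v
  proof -
    have "card {e \<in> ?E. v \<notin> e} \<le> turan_size (card (?V - {v}))"
    proof (rule bound[OF uniform3_delete[OF unif]])
      show "cross_sparse 15 {e \<in> ?E. v \<notin> e}" by (rule cross_sparse_subset[OF unif sparse]) auto
      show "N + 2 ^ N \<le> card (?V - {v})" using m v by simp
    qed
    moreover have "card (?V - {v}) = m" using m(1) v by simp
    ultimately show ?thesis
      using card_delete[OF uniform3_finite_edges[OF unif], of v] eq m(1) n(1) by simp
  qed
  moreover have m16: "m \<ge> 10 ^ 16" using m(2) N by linarith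
  ultimately obtain h where h: "rainbow ?V h ?E"
    using rainbow_of_turan_degrees[OF unif sparse m(1)] by blast
  have fin: "finite ?V" by (rule uniform3_finite[OF unif])
  have col: "h ` ?V \<subseteq> {..<5}" using h unfolding rainbow_def by blast
  have "(3::nat) \<le> 10 ^ 16" by simp
  then have n3: "card ?V \<ge> 3" using m(1) m16 by linarith
  have "?E = full ?V h"
  proof (rule card_seteq)
    show "finite (full ?V h)" by (rule uniform3_finite_edges[OF uniform3_full[OF fin]])
    show "?E \<subseteq> full ?V h" by (rule rainbow_subset_full[OF unif h])
    show "card (full ?V h) \<le> card ?E" using full_le_turan_size(1)[OF fin n3 col] eq n(1) by simp
  qed
  then show "isomorphic G (turan_graph n)"
    using full_le_turan_size(2)[OF fin n3 col, of G] eq n(1) by simp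
qed

theorem theorem1p1:
  shows "(\<forall>\<^sub>F n in sequentially. turan_number n K33 = turan_size n) \<and>
    (\<forall>\<^sub>F n in sequentially. \<forall>G :: 'a hypergraph.
       three_graph G \<and> card (verts G) = n \<and> is_free K33 G \<and> card (edges G) = turan_size n
       \<longrightarrow> isomorphic G (turan_graph n))"
proof -
  \<comment> \<open>Keeping \<open>N\<close> opaque avoids ever computing the threshold
    \<open>N + 2 ^ N + 1\<close>.\<close>
  obtain N :: nat where N: "N \<ge> 10 ^ 16" by blast
  have "turan_number n K33 = turan_size n" if n: "n \<ge> N + 2 ^ N + 1" for n
  proof -
  let ?S = "{card (edges G) | G :: nat hypergraph. three_graph G \<and> card (verts G) = n \<and> is_free K33 G}"
  have le: "k \<le> turan_size n" if "k \<in> ?S" for k using that turan_K33(1)[OF _ _ _ n N] by auto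
  have "is_free K33 (turan_graph n)"
    by (rule rainbow_K33_free[of _ "\<lambda>v. v mod 5"])
      (auto simp: rainbow_def turan_graph_verts turan_graph_edges full_def)
  then have "turan_size n \<in> ?S"
    using turan_graph_three_graph[of n] unfolding turan_size_def
    by (auto simp: turan_graph_verts intro!: exI[of _ "turan_graph n"])
  moreover have "finite ?S" using le by (intro finite_subset[of ?S "{..turan_size n}"]) auto
  ultimately show ?thesis
    unfolding turan_number_def using le by (intro Max_eqI) auto
  qed
  moreover have "\<forall>G :: 'a hypergraph. three_graph G \<and> card (verts G) = n \<and> is_free K33 G \<and>
      card (edges G) = turan_size n \<longrightarrow> isomorphic G (turan_graph n)" if "n \<ge> N + 2 ^ N + 1" for n
    using turan_K33(2)[OF _ _ _ that N] by blast
  ultimately show ?thesis unfolding eventually_sequentially by blast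
qed

end
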